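(* Let $n\ge m\ge1$ be integers and let $(X_t)_{t\ge0}$ be a Laguerre process $L(n,m,X_0)$ with eigenvalues $\lambda_1(t),\dots,\lambda_m(t)$. If at time $t=0$ the eigenvalues of $X$ are distinct, then they never collide, i.e. $\tau=\infty$ almost surely, where $\tau=\inf\{t:\lambda_i(t)=\lambda_j(t)\text{ for some }i\ne j\}$.
   Context: The Laguerre process $L(n,m,X_0)$ is $X_t=B_t^\star B_t$ where $B$ is an $n\times m$ complex Brownian matrix with $B_0^\star B_0=X_0$, i.e. $B=B^1+iB^2$ with $B^1,B^2$ independent real matrices whose entries are independent standard real Brownian motions. *)

theory Defs
  imports "HOL-Probability.Probability" "Jordan_Normal_Form.Schur_Decomposition"
begin

definition standard_brownian_motion :: "'a measure \<Rightarrow> (real \<Rightarrow> 'a \<Rightarrow> real) \<Rightarrow> bool" where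
  "standard_brownian_motion M W \<longleftrightarrow>
     prob_space M \<and>
     (\<forall>t\<ge>0. W t \<in> borel_measurable M) \<and>
     (AE \<omega> in M. W 0 \<omega> = 0) \<and>
     (AE \<omega> in M. continuous_on {0..} (\<lambda>t. W t \<omega>)) \<and>
     (\<forall>t::nat \<Rightarrow> real. 0 \<le> t 0 \<longrightarrow> mono t \<longrightarrow>
        prob_space.indep_vars M (\<lambda>_. borel) (\<lambda>k \<omega>. W (t (Suc k)) \<omega> - W (t k) \<omega>) UNIV) \<and>
     (\<forall>s t. 0 \<le> s \<longrightarrow> s < t \<longrightarrow>
        distributed M lborel (\<lambda>\<omega>. W t \<omega> - W s \<omega>) (normal_density 0 (sqrt (t - s))))"

text \<open>The real coordinates of an \<open>n \<times> m\<close> complex matrix are indexed by triples: \<open>(False, i, j)\<close>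
  is the real part and \<open>(True, i, j)\<close> the imaginary part of the entry \<open>(i, j)\<close>.\<close>

definition coord_index :: "nat \<Rightarrow> nat \<Rightarrow> (bool \<times> nat \<times> nat) set" where
  "coord_index n m = UNIV \<times> {..<n} \<times> {..<m}"

fun real_coord :: "complex mat \<Rightarrow> bool \<times> nat \<times> nat \<Rightarrow> real" where
  "real_coord A (b, i, j) = (if b then Im (A $$ (i, j)) else Re (A $$ (i, j)))"

text \<open>Independence of processes is independence of their paths, seen as random elements of the
  product space over the time axis \<open>{0..}\<close>. The initial matrix \<open>B 0\<close> may be random (in particular
  constant); it is then independent of the driving noise \<open>B - B 0\<close>.\<close>

definition complex_brownian_matrix ::
  "'a measure \<Rightarrow> nat \<Rightarrow> nat \<Rightarrow> (real \<Rightarrow> 'a \<Rightarrow> complex mat) \<Rightarrow> bool" where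
  "complex_brownian_matrix M n m B \<longleftrightarrow>
     prob_space M \<and>
     (\<forall>t\<ge>0. \<forall>\<omega>\<in>space M. B t \<omega> \<in> carrier_mat n m) \<and>
     (let K = coord_index n m;
          W = (\<lambda>k t \<omega>. real_coord (B t \<omega>) k - real_coord (B 0 \<omega>) k)
      in (\<forall>k\<in>K. standard_brownian_motion M (W k)) \<and>
         prob_space.indep_vars M (\<lambda>_. PiM {0..} (\<lambda>_. borel)) (\<lambda>k \<omega>. \<lambda>t\<in>{0..}. W k t \<omega>) K \<and>
         prob_space.indep_set M
           (sets (vimage_algebra (space M) (\<lambda>\<omega>. \<lambda>k\<in>K. real_coord (B 0 \<omega>) k) (PiM K (\<lambda>_. borel))))
           (sets (vimage_algebra (space M) (\<lambda>\<omega>. \<lambda>k\<in>K. \<lambda>t\<in>{0..}. W k t \<omega>)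
              (PiM K (\<lambda>_. PiM {0..} (\<lambda>_. borel))))))"

definition laguerre_process ::
  "'a measure \<Rightarrow> nat \<Rightarrow> nat \<Rightarrow> ('a \<Rightarrow> complex mat) \<Rightarrow> (real \<Rightarrow> 'a \<Rightarrow> complex mat) \<Rightarrow> bool" where
  "laguerre_process M n m X0 X \<longleftrightarrow>
     (\<exists>B. complex_brownian_matrix M n m B \<and>
          (\<forall>\<omega>\<in>space M. mat_adjoint (B 0 \<omega>) * B 0 \<omega> = X0 \<omega>) \<and>
          (\<forall>t\<ge>0. \<forall>\<omega>\<in>space M. X t \<omega> = mat_adjoint (B t \<omega>) * B t \<omega>))"

text \<open>The reals \<open>l 0, \<dots>, l (d - 1)\<close> are the eigenvalues of the \<open>d \<times> d\<close> matrix \<open>A\<close>, listed with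
  algebraic multiplicity in an arbitrary order.\<close>

definition lists_eigenvalues :: "complex mat \<Rightarrow> (nat \<Rightarrow> real) \<Rightarrow> bool" where
  "lists_eigenvalues A l \<longleftrightarrow>
     char_poly A = (\<Prod>i<dim_row A. [:- complex_of_real (l i), 1:])"

definition collision_time :: "nat \<Rightarrow> (nat \<Rightarrow> real \<Rightarrow> 'a \<Rightarrow> real) \<Rightarrow> 'a \<Rightarrow> ereal" where
  "collision_time m l \<omega> =
     Inf {ereal t | t. 0 \<le> t \<and> (\<exists>i<m. \<exists>j<m. i \<noteq> j \<and> l i t \<omega> = l j t \<omega>)}"

end

theory Submission
  imports Defs
begin

text \<open>The matrices \<open>A\<close> for which \<open>A\<^sup>* A\<close> has a double eigenvalue form a set of real codimension three
in the \<open>2nm\<close>-dimensional space of complex \<open>n \<times> m\<close> matrices, and Brownian motion started anywhere does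
not meet such a set at positive times. At time \<open>0\<close> the absence of a collision is the hypothesis.

\<^emph>\<open>Why codimension three is avoided.\<close> Codimension three is used only in the form of a covering property
(\<open>thin\<close>): up to a constant, \<open>\<epsilon>\<close> to the power \<open>-(2nm - 3)\<close> cubes of side \<open>\<epsilon>\<close> cover the set. A Brownian
path is Hoelder continuous of order \<open>2/5\<close>: on time intervals of length \<open>32\<^sup>-\<^sup>k\<close> it moves by at most a
constant times \<open>\<epsilon> = 4\<^sup>-\<^sup>k\<close>, for all large \<open>k\<close>. If it meets the set before time \<open>T\<close>, then at one of the
\<open>T 32\<^sup>k\<close> grid times it lies near one of the covering cubes. At times bounded away from \<open>0\<close> each
cube is hit with probability of order \<open>\<epsilon>\<close> to the power \<open>2nm\<close>, because the Gaussian increment has a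
bounded density and is independent of the initial matrix. So the union has probability of order
\<open>32\<^sup>k \<epsilon>\<^sup>3 = 2\<^sup>-\<^sup>k\<close>, and Borel--Cantelli applies (\<open>brownian_matrix_avoids_thin\<close>). Any order in
\<open>(1/3, 1/2)\<close> would do; \<open>2/5\<close> makes both scales integer powers.

\<^emph>\<open>Why the codimension is three.\<close> A double eigenvalue \<open>\<mu>\<close> of the Hermitian matrix \<open>A\<^sup>* A\<close> has two
independent eigenvectors \<open>u\<close>, \<open>v\<close>, which can be put in echelon form with respect to two coordinates
\<open>p\<close>, \<open>q\<close> (\<open>double_eigenvalue_eigen_pair\<close>). If \<open>\<mu> \<noteq> 0\<close>, the images \<open>y = A u\<close> and \<open>z = A v\<close> are independent.
Given \<open>u\<close>, \<open>v\<close> and \<open>y\<close>, the eigenvalue equations determine \<open>\<mu>\<close>, impose three real conditions on \<open>z\<close>, and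
two complex conditions on each further column of \<open>A\<close>. These last conditions are compensated exactly by the
free entries of \<open>u\<close> and \<open>v\<close>, so \<open>2nm - 3\<close> real parameters remain (\<open>thin_independent_image_pairs\<close>).
If \<open>\<mu> = 0\<close>, then \<open>A\<close> vanishes on the plane of \<open>u\<close> and \<open>v\<close>, which for \<open>m \<le> n\<close> leaves even fewer parameters
(\<open>thin_null_pairs\<close>). The two families of sets, with all bounds natural numbers, are countable
and exhaust the matrices with a double eigenvalue (\<open>eigen_pair_cases\<close>).\<close>

section \<open>Thin sets and Lipschitz parameters\<close>

text \<open>Thin sets are those of upper box dimension at most \<open>2nm - 3\<close> with a uniform constant: \<open>F\<close> holds the
centres of the covering cubes. The bound on the number of centres is multiplied by \<open>\<epsilon>\<close> to the power
\<open>2nm\<close>, which keeps all exponents natural numbers. A set of matrices is a set of functions on all index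
pairs, of which only the values at \<open>i < n\<close>, \<open>j < m\<close> matter.\<close>

definition thin :: "nat \<Rightarrow> nat \<Rightarrow> (nat \<Rightarrow> nat \<Rightarrow> complex) set \<Rightarrow> bool" where
  "thin n m S \<longleftrightarrow>
     (\<exists>C\<ge>1. \<forall>\<epsilon>. 0 < \<epsilon> \<longrightarrow> \<epsilon> \<le> 1 \<longrightarrow>
        (\<exists>F. finite F \<and> real (card F) * \<epsilon> ^ (2 * n * m) \<le> C * \<epsilon> ^ 3 \<and>
             (\<forall>A\<in>S. \<exists>G\<in>F. \<forall>i<n. \<forall>j<m. cmod (A i j - G i j) \<le> C * \<epsilon>)))"

definition param_dist ::
  "'e set \<Rightarrow> ('x \<Rightarrow> 'e \<Rightarrow> complex) \<Rightarrow> ('x \<Rightarrow> real) \<Rightarrow> 'x \<Rightarrow> 'x \<Rightarrow> real" where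
  "param_dist Q \<phi> \<theta> x x' = (\<Sum>e\<in>Q. cmod (\<phi> x e - \<phi> x' e)) + \<bar>\<theta> x - \<theta> x'\<bar>"

lemma floor_cell_bound:
  fixes a N \<epsilon> :: real
  assumes "\<bar>a\<bar> \<le> N" "0 < \<epsilon>"
  shows "\<lfloor>a / \<epsilon>\<rfloor> \<in> {\<lfloor>- (N / \<epsilon>)\<rfloor>..\<lfloor>N / \<epsilon>\<rfloor>}"
proof -
  have "\<bar>a / \<epsilon>\<bar> \<le> N / \<epsilon>"
    using assms by (simp add: abs_divide divide_right_mono)
  then have "- (N / \<epsilon>) \<le> a / \<epsilon>" "a / \<epsilon> \<le> N / \<epsilon>" by linarith+
  then show ?thesis by (simp add: floor_mono)
qed

lemma floor_cell_card:
  fixes N \<epsilon> :: real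
  assumes "0 \<le> N" "0 < \<epsilon>" "\<epsilon> \<le> 1"
  shows "real (card {\<lfloor>- (N / \<epsilon>)\<rfloor>..\<lfloor>N / \<epsilon>\<rfloor>}) * \<epsilon> \<le> 2 * N + 3"
proof -
  have le: "\<lfloor>- (N / \<epsilon>)\<rfloor> \<le> \<lfloor>N / \<epsilon>\<rfloor>"
    using assms by (intro floor_mono divide_right_mono) auto
  have "real (card {\<lfloor>- (N / \<epsilon>)\<rfloor>..\<lfloor>N / \<epsilon>\<rfloor>}) = of_int \<lfloor>N / \<epsilon>\<rfloor> - of_int \<lfloor>- (N / \<epsilon>)\<rfloor> + 1"
    using le by simp
  also have "\<dots> \<le> N / \<epsilon> - (- (N / \<epsilon>) - 1) + 1"
    by linarith
  also have "\<dots> = (2 * N + 2 * \<epsilon>) / \<epsilon>"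
    using assms by (simp add: field_simps)
  finally have "real (card {\<lfloor>- (N / \<epsilon>)\<rfloor>..\<lfloor>N / \<epsilon>\<rfloor>}) * \<epsilon> \<le> 2 * N + 2 * \<epsilon>"
    using assms by (simp add: pos_le_divide_eq)
  with assms show ?thesis by linarith
qed

lemma same_floor_close:
  fixes a b \<epsilon> :: real
  assumes "\<lfloor>a / \<epsilon>\<rfloor> = \<lfloor>b / \<epsilon>\<rfloor>" "0 < \<epsilon>"
  shows "\<bar>a - b\<bar> \<le> \<epsilon>"
proof -
  have "\<bar>a / \<epsilon> - b / \<epsilon>\<bar> \<le> 1" using assms(1) by linarith
  hence "\<bar>(a - b) / \<epsilon>\<bar> \<le> 1" by (simp add: diff_divide_distrib)
  with assms(2) show ?thesis by (simp add: abs_divide)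
qed

text \<open>If \<open>nm - 2\<close> complex parameters and one real parameter determine the matrix in a Lipschitz way, then the set
is thin: there are at most a constant times \<open>\<epsilon>\<close> to the power \<open>-(2nm - 3)\<close> cells of side \<open>\<epsilon>\<close> in parameter
space, and one representative per occupied cell serves as a centre. In this way the parametrisation
need neither be inverted nor have an open domain.\<close>

lemma thin_if_lipschitz_parametrised:
  fixes Z :: "'x set" and \<phi> :: "'x \<Rightarrow> 'e \<Rightarrow> complex" and f :: "'x \<Rightarrow> nat \<Rightarrow> nat \<Rightarrow> complex"
  assumes Q: "finite Q" "card Q + 2 = n * m"
    and bound: "\<And>x e. x \<in> Z \<Longrightarrow> e \<in> Q \<Longrightarrow> cmod (\<phi> x e) \<le> N"
    and bound': "\<And>x. x \<in> Z \<Longrightarrow> \<bar>\<theta> x\<bar> \<le> N"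
    and lip: "\<And>x x' i j. x \<in> Z \<Longrightarrow> x' \<in> Z \<Longrightarrow> i < n \<Longrightarrow> j < m \<Longrightarrow>
                cmod (f x i j - f x' i j) \<le> L * param_dist Q \<phi> \<theta> x x'"
  shows "thin n m (f ` Z)"
proof (cases "Z = {}")
  case True
  then show ?thesis unfolding thin_def by (intro exI[of _ 1]) (auto intro!: exI[of _ "{}"])
next
  case False
  then have N0: "0 \<le> N" using bound' by (meson abs_ge_zero equals0I order_trans)
  define q where "q = card Q"
  define C where "C = max 1 (max (\<bar>L\<bar> * (2 * q + 1)) ((2 * N + 3) ^ (2 * q + 1)))"
  have "\<exists>F. finite F \<and> real (card F) * \<epsilon> ^ (2 * n * m) \<le> C * \<epsilon> ^ 3 \<and>
             (\<forall>A\<in>f ` Z. \<exists>G\<in>F. \<forall>i<n. \<forall>j<m. cmod (A i j - G i j) \<le> C * \<epsilon>)"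
    if e: "0 < \<epsilon>" "\<epsilon> \<le> 1" for \<epsilon> :: real
  proof -
    define I where "I = {\<lfloor>- (N / \<epsilon>)\<rfloor>..\<lfloor>N / \<epsilon>\<rfloor>}"
    define key where "key x = (\<lambda>e\<in>Q. (\<lfloor>Re (\<phi> x e) / \<epsilon>\<rfloor>, \<lfloor>Im (\<phi> x e) / \<epsilon>\<rfloor>), \<lfloor>\<theta> x / \<epsilon>\<rfloor>)" for x
    \<comment> \<open>one representative for each occupied cell; \<open>key\<close> names the cell of a point\<close>
    define rep where "rep c = (SOME x. x \<in> Z \<and> key x = c)" for c
    have rep: "rep (key x) \<in> Z \<and> key (rep (key x)) = key x" if "x \<in> Z" for x
      unfolding rep_def using someI[of "\<lambda>y. y \<in> Z \<and> key y = key x" x] that by auto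
    have ri: "\<bar>Re (\<phi> x e)\<bar> \<le> N" "\<bar>Im (\<phi> x e)\<bar> \<le> N" if "x \<in> Z" "e \<in> Q" for x e
      using bound[OF that] abs_Re_le_cmod[of "\<phi> x e"] abs_Im_le_cmod[of "\<phi> x e"] by linarith+
    have sub: "key ` Z \<subseteq> (\<Pi>\<^sub>E e\<in>Q. I \<times> I) \<times> I"
      unfolding key_def I_def using e ri bound'
      by (auto intro!: floor_cell_bound simp del: atLeastAtMost_iff)
    have fin: "finite ((\<Pi>\<^sub>E e\<in>Q. I \<times> I) \<times> I)"
      using Q by (intro finite_cartesian_product finite_PiE) (auto simp: I_def)
    have cardE: "card ((\<Pi>\<^sub>E e\<in>Q. I \<times> I) \<times> I) = card I ^ (2 * q + 1)"
      using Q by (simp add: card_cartesian_product card_PiE q_def power_mult power2_eq_square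
          power_mult_distrib power_add)
    define F where "F = f ` rep ` key ` Z"
    have finK: "finite (key ` Z)" using fin sub by (rule finite_subset[rotated])
    have "card F \<le> card (key ` Z)"
      unfolding F_def using finK by (metis card_image_le finite_imageI order_trans)
    also have "\<dots> \<le> card I ^ (2 * q + 1)"
      using card_mono[OF fin sub] cardE by simp
    finally have cF: "real (card F) \<le> real (card I) ^ (2 * q + 1)"
      by (metis of_nat_le_iff of_nat_power)
    have nm: "2 * n * m = (2 * q + 1) + 3" using Q by (simp add: q_def)
    have "real (card F) * \<epsilon> ^ (2 * n * m) \<le> real (card I) ^ (2 * q + 1) * \<epsilon> ^ (2 * n * m)"
      using cF e by (intro mult_right_mono) auto
    also have "\<dots> = (real (card I) * \<epsilon>) ^ (2 * q + 1) * \<epsilon> ^ 3"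
      unfolding nm by (simp only: power_add power_mult_distrib mult_ac)
    also have "\<dots> \<le> (2 * N + 3) ^ (2 * q + 1) * \<epsilon> ^ 3"
      using floor_cell_card[OF N0 e] e unfolding I_def
      by (intro mult_right_mono power_mono) auto
    also have "\<dots> \<le> C * \<epsilon> ^ 3"
      using e unfolding C_def by (intro mult_right_mono) auto
    finally have 1: "real (card F) * \<epsilon> ^ (2 * n * m) \<le> C * \<epsilon> ^ 3" .
    have 2: "\<exists>G\<in>F. \<forall>i<n. \<forall>j<m. cmod (f x i j - G i j) \<le> C * \<epsilon>" if x: "x \<in> Z" for x
    proof -
      define y where "y = rep (key x)"
      have y: "y \<in> Z" "key y = key x" using rep[OF x] by (auto simp: y_def)
      have "cmod (\<phi> x e - \<phi> y e) \<le> 2 * \<epsilon>" if "e \<in> Q" for e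
      proof -
        have eq: "(\<lambda>e\<in>Q. (\<lfloor>Re (\<phi> y e) / \<epsilon>\<rfloor>, \<lfloor>Im (\<phi> y e) / \<epsilon>\<rfloor>)) e =
            (\<lambda>e\<in>Q. (\<lfloor>Re (\<phi> x e) / \<epsilon>\<rfloor>, \<lfloor>Im (\<phi> x e) / \<epsilon>\<rfloor>)) e"
          using y(2) unfolding key_def by (auto dest: fun_cong)
        have "\<bar>Re (\<phi> x e) - Re (\<phi> y e)\<bar> \<le> \<epsilon>" "\<bar>Im (\<phi> x e) - Im (\<phi> y e)\<bar> \<le> \<epsilon>"
          using eq that e(1) by (auto intro!: same_floor_close)
        then show ?thesis using cmod_le[of "\<phi> x e - \<phi> y e"] by simp
      qed
      hence "(\<Sum>e\<in>Q. cmod (\<phi> x e - \<phi> y e)) \<le> q * (2 * \<epsilon>)"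
        unfolding q_def by (rule sum_bounded_above)
      moreover have "\<bar>\<theta> x - \<theta> y\<bar> \<le> \<epsilon>"
        using y(2) e(1) unfolding key_def by (intro same_floor_close) auto
      ultimately have pd: "param_dist Q \<phi> \<theta> x y \<le> (2 * q + 1) * \<epsilon>"
        unfolding param_dist_def by (simp add: algebra_simps)
      have pd0: "0 \<le> param_dist Q \<phi> \<theta> x y"
        unfolding param_dist_def by (intro add_nonneg_nonneg sum_nonneg) auto
      have "cmod (f x i j - f y i j) \<le> C * \<epsilon>" if "i < n" "j < m" for i j
      proof -
        have "cmod (f x i j - f y i j) \<le> \<bar>L\<bar> * param_dist Q \<phi> \<theta> x y"
          using lip[OF x y(1) that] pd0 by (smt (verit) mult_right_mono)
        also have "\<dots> \<le> \<bar>L\<bar> * ((2 * q + 1) * \<epsilon>)"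
          using pd by (intro mult_left_mono) auto
        also have "\<dots> \<le> C * \<epsilon>"
          unfolding mult.assoc[symmetric] C_def using e by (intro mult_right_mono) auto
        finally show ?thesis .
      qed
      moreover have "f y \<in> F" unfolding F_def y_def using x by auto
      ultimately show ?thesis by blast
    qed
    show ?thesis using 1 2 finK unfolding F_def
      by (intro exI[of _ F]) (auto simp: F_def)
  qed
  moreover have "1 \<le> C" by (simp add: C_def)
  ultimately show ?thesis unfolding thin_def by blast
qed

text \<open>Lipschitz dependence on the parameters is verified by calculus: bounded Lipschitz functions are closed
under the operations by which the matrix entries are recovered from the parameters. The gauge \<open>D\<close> will be
the distance of the parameter vectors.\<close>

locale lipschitz_gauge =
  fixes Z :: "'x set" and D :: "'x \<Rightarrow> 'x \<Rightarrow> real"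
  assumes D_nonneg: "0 \<le> D x y"
begin

definition bd_lipschitz :: "('x \<Rightarrow> complex) \<Rightarrow> bool" where
  "bd_lipschitz f \<longleftrightarrow> (\<exists>K\<ge>0. (\<forall>x\<in>Z. cmod (f x) \<le> K) \<and> (\<forall>x\<in>Z. \<forall>y\<in>Z. cmod (f x - f y) \<le> K * D x y))"

lemma bd_lipschitzI:
  assumes "\<And>x. x \<in> Z \<Longrightarrow> cmod (f x) \<le> K" "\<And>x y. x \<in> Z \<Longrightarrow> y \<in> Z \<Longrightarrow> cmod (f x - f y) \<le> L * D x y"
  shows "bd_lipschitz f"
proof -
  define M where "M = max 0 (max K L)"
  have "cmod (f x - f y) \<le> M * D x y" if "x \<in> Z" "y \<in> Z" for x y
  proof -
    have "L * D x y \<le> M * D x y" unfolding M_def by (intro mult_right_mono D_nonneg) auto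
    with assms(2)[OF that] show ?thesis by linarith
  qed
  moreover have "cmod (f x) \<le> M" if "x \<in> Z" for x using assms(1)[OF that] by (auto simp: M_def)
  ultimately show ?thesis unfolding bd_lipschitz_def by (intro exI[of _ M]) (auto simp: M_def)
qed

lemma bd_lipschitz_cong: "bd_lipschitz f \<Longrightarrow> (\<And>x. x \<in> Z \<Longrightarrow> f x = g x) \<Longrightarrow> bd_lipschitz g"
  unfolding bd_lipschitz_def by simp

lemma bd_lipschitz_const [intro]: "bd_lipschitz (\<lambda>_. c)"
  by (rule bd_lipschitzI[where K = "cmod c" and L = 0]) auto

lemma bd_lipschitz_add [intro]:
  assumes "bd_lipschitz f" "bd_lipschitz g" shows "bd_lipschitz (\<lambda>x. f x + g x)"
proof -
  obtain K where K: "0 \<le> K" "\<And>x. x \<in> Z \<Longrightarrow> cmod (f x) \<le> K"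
    "\<And>x y. x \<in> Z \<Longrightarrow> y \<in> Z \<Longrightarrow> cmod (f x - f y) \<le> K * D x y" using assms(1) unfolding bd_lipschitz_def by blast
  obtain L where L: "0 \<le> L" "\<And>x. x \<in> Z \<Longrightarrow> cmod (g x) \<le> L"
    "\<And>x y. x \<in> Z \<Longrightarrow> y \<in> Z \<Longrightarrow> cmod (g x - g y) \<le> L * D x y" using assms(2) unfolding bd_lipschitz_def by blast
  show ?thesis
  proof (rule bd_lipschitzI[where K = "K + L" and L = "K + L"])
    fix x assume "x \<in> Z" then show "cmod (f x + g x) \<le> K + L"
      using K L by (meson add_mono norm_triangle_le)
  next
    fix x y assume xy: "x \<in> Z" "y \<in> Z"
    have "cmod (f x + g x - (f y + g y)) \<le> cmod (f x - f y) + cmod (g x - g y)"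
      by (metis add_diff_add norm_triangle_ineq)
    then show "cmod (f x + g x - (f y + g y)) \<le> (K + L) * D x y"
      using K(3)[OF xy] L(3)[OF xy] by (simp add: distrib_right)
  qed
qed

lemma bd_lipschitz_mult [intro]:
  assumes "bd_lipschitz f" "bd_lipschitz g" shows "bd_lipschitz (\<lambda>x. f x * g x)"
proof -
  obtain K where K: "0 \<le> K" "\<And>x. x \<in> Z \<Longrightarrow> cmod (f x) \<le> K"
    "\<And>x y. x \<in> Z \<Longrightarrow> y \<in> Z \<Longrightarrow> cmod (f x - f y) \<le> K * D x y" using assms(1) unfolding bd_lipschitz_def by blast
  obtain L where L: "0 \<le> L" "\<And>x. x \<in> Z \<Longrightarrow> cmod (g x) \<le> L"
    "\<And>x y. x \<in> Z \<Longrightarrow> y \<in> Z \<Longrightarrow> cmod (g x - g y) \<le> L * D x y" using assms(2) unfolding bd_lipschitz_def by blast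
  show ?thesis
  proof (rule bd_lipschitzI[where K = "K * L" and L = "2 * K * L"])
    fix x assume "x \<in> Z" then show "cmod (f x * g x) \<le> K * L"
      unfolding norm_mult using K L by (intro mult_mono) auto
  next
    fix x y assume xy: "x \<in> Z" "y \<in> Z"
    have "f x * g x - f y * g y = f x * (g x - g y) + (f x - f y) * g y"
      by (simp add: algebra_simps)
    then have "cmod (f x * g x - f y * g y) \<le> cmod (f x) * cmod (g x - g y) + cmod (f x - f y) * cmod (g y)"
      by (metis norm_mult norm_triangle_ineq)
    also have "\<dots> \<le> K * (L * D x y) + (K * D x y) * L"
      using K(2)[OF xy(1)] L(2)[OF xy(2)] K(3)[OF xy] L(3)[OF xy] K(1) L(1) D_nonneg
      by (intro add_mono mult_mono mult_nonneg_nonneg) auto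
    finally show "cmod (f x * g x - f y * g y) \<le> 2 * K * L * D x y" by (simp add: mult_ac)
  qed
qed

lemma bd_lipschitz_diff [intro]:
  assumes "bd_lipschitz f" "bd_lipschitz g" shows "bd_lipschitz (\<lambda>x. f x - g x)"
proof -
  have "bd_lipschitz (\<lambda>x. f x + (-1) * g x)"
    by (intro bd_lipschitz_add bd_lipschitz_mult bd_lipschitz_const assms)
  then show ?thesis by simp
qed

lemma bd_lipschitz_cnj [intro]: "bd_lipschitz f \<Longrightarrow> bd_lipschitz (\<lambda>x. cnj (f x))"
  unfolding bd_lipschitz_def by (simp flip: complex_cnj_diff)

lemma bd_lipschitz_sum [intro]:
  "(\<And>i. i \<in> I \<Longrightarrow> bd_lipschitz (f i)) \<Longrightarrow> bd_lipschitz (\<lambda>x. \<Sum>i\<in>I. f i x)"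
  by (induction I rule: infinite_finite_induct) (auto intro: bd_lipschitz_add)

text \<open>Division and square root are Lipschitz only away from \<open>0\<close>; this is why the sets of matrices below carry
explicit lower bounds.\<close>

lemma bd_lipschitz_divide:
  assumes "bd_lipschitz f" "bd_lipschitz g" "0 < c" "\<And>x. x \<in> Z \<Longrightarrow> c \<le> cmod (g x)"
  shows "bd_lipschitz (\<lambda>x. f x / g x)"
proof -
  obtain L where L: "0 \<le> L" "\<And>x. x \<in> Z \<Longrightarrow> cmod (g x) \<le> L"
    "\<And>x y. x \<in> Z \<Longrightarrow> y \<in> Z \<Longrightarrow> cmod (g x - g y) \<le> L * D x y" using assms(2) unfolding bd_lipschitz_def by blast
  have "bd_lipschitz (\<lambda>x. inverse (g x))"
  proof (rule bd_lipschitzI[where K = "inverse c" and L = "inverse c * L * inverse c"])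
    fix x assume "x \<in> Z" then show "cmod (inverse (g x)) \<le> inverse c"
      using assms(3,4) by (simp add: norm_inverse le_imp_inverse_le)
  next
    fix x y assume xy: "x \<in> Z" "y \<in> Z"
    have nz: "g x \<noteq> 0" "g y \<noteq> 0" using assms(3) assms(4)[OF xy(1)] assms(4)[OF xy(2)] by auto
    have "cmod (inverse (g x) - inverse (g y)) = inverse (cmod (g x)) * cmod (g x - g y) * inverse (cmod (g y))"
      by (simp add: inverse_diff_inverse[OF nz] norm_mult norm_inverse)
    also have "\<dots> \<le> inverse c * (L * D x y) * inverse c"
      using assms(3) assms(4)[OF xy(1)] assms(4)[OF xy(2)] L(1) L(3)[OF xy] D_nonneg
      by (intro mult_mono) (auto intro!: le_imp_inverse_le mult_nonneg_nonneg)
    finally show "cmod (inverse (g x) - inverse (g y)) \<le> inverse c * L * inverse c * D x y"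
      by (simp add: mult_ac)
  qed
  with assms(1) show ?thesis unfolding divide_inverse by (rule bd_lipschitz_mult)
qed

lemma bd_lipschitz_sqrt:
  assumes "bd_lipschitz (\<lambda>x. of_real (h x))" "0 < c" "\<And>x. x \<in> Z \<Longrightarrow> c \<le> h x"
  shows "bd_lipschitz (\<lambda>x. of_real (sqrt (h x)))"
proof -
  obtain L where L: "0 \<le> L" "\<And>x. x \<in> Z \<Longrightarrow> cmod (of_real (h x)) \<le> L"
    "\<And>x y. x \<in> Z \<Longrightarrow> y \<in> Z \<Longrightarrow> cmod (of_real (h x) - of_real (h y)) \<le> L * D x y"
    using assms(1) unfolding bd_lipschitz_def by blast
  have L2: "h x \<le> L" if "x \<in> Z" for x using L(2)[OF that] by simp
  have L3: "\<bar>h x - h y\<bar> \<le> L * D x y" if "x \<in> Z" "y \<in> Z" for x y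
    using L(3)[OF that] by (simp flip: of_real_diff)
  show ?thesis
  proof (rule bd_lipschitzI[where K = "sqrt L" and L = "L / sqrt c"])
    fix x assume "x \<in> Z" then show "cmod (of_real (sqrt (h x))) \<le> sqrt L"
      using L2 assms(2) assms(3)[of x] by simp
  next
    fix x y assume xy: "x \<in> Z" "y \<in> Z"
    have h: "c \<le> h x" "c \<le> h y" using assms(3) xy by auto
    have sx: "sqrt c \<le> sqrt (h x)" "0 < sqrt c" "0 \<le> sqrt (h y)" using h assms(2) by auto
    have "\<bar>sqrt (h x) - sqrt (h y)\<bar> * sqrt c \<le> \<bar>sqrt (h x) - sqrt (h y)\<bar> * (sqrt (h x) + sqrt (h y))"
      using sx by (intro mult_left_mono) linarith+
    also have "\<dots> = \<bar>(sqrt (h x) - sqrt (h y)) * (sqrt (h x) + sqrt (h y))\<bar>"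
      using sx by (simp add: abs_mult)
    also have "(sqrt (h x) - sqrt (h y)) * (sqrt (h x) + sqrt (h y)) = h x - h y"
      using h assms(2) by (simp add: algebra_simps)
    also have "\<bar>h x - h y\<bar> \<le> L * D x y" by (rule L3[OF xy])
    finally have "\<bar>sqrt (h x) - sqrt (h y)\<bar> \<le> L * D x y / sqrt c"
      using sx by (simp add: pos_le_divide_eq)
    then show "cmod (complex_of_real (sqrt (h x)) - of_real (sqrt (h y))) \<le> L / sqrt c * D x y"
      by (simp flip: of_real_diff)
  qed
qed

lemma bd_lipschitz_cis:
  assumes "\<And>x y. x \<in> Z \<Longrightarrow> y \<in> Z \<Longrightarrow> \<bar>\<theta> x - \<theta> y\<bar> \<le> D x y"
  shows "bd_lipschitz (\<lambda>x. cis (\<theta> x))"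
proof (rule bd_lipschitzI[where K = 1 and L = 1])
  fix x y assume xy: "x \<in> Z" "y \<in> Z"
  have "cis (\<theta> x) - cis (\<theta> y) = cis (\<theta> y) * (cis (\<theta> x - \<theta> y) - 1)"
    by (simp add: right_diff_distrib cis_mult)
  then have "cmod (cis (\<theta> x) - cis (\<theta> y)) = cmod (exp (\<i> * of_real (\<theta> x - \<theta> y)) - 1)"
    by (simp add: norm_mult cis_conv_exp)
  also have "\<dots> = 2 * \<bar>sin ((\<theta> x - \<theta> y) / 2)\<bar>"
    by (rule dist_exp_i_1)
  also have "\<dots> \<le> \<bar>\<theta> x - \<theta> y\<bar>"
    using abs_sin_x_le_abs_x[of "(\<theta> x - \<theta> y) / 2"] by simp
  also have "\<dots> \<le> D x y" by (rule assms[OF xy])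
  finally show "cmod (cis (\<theta> x) - cis (\<theta> y)) \<le> 1 * D x y" by simp
qed auto

end

lemma lipschitz_gauge_param_dist: "lipschitz_gauge (param_dist Q \<phi> \<theta>)"
  by unfold_locales (auto simp: param_dist_def intro!: add_nonneg_nonneg sum_nonneg)

abbreviation bd_lipschitz_wrt ::
  "'x set \<Rightarrow> 'e set \<Rightarrow> ('x \<Rightarrow> 'e \<Rightarrow> complex) \<Rightarrow> ('x \<Rightarrow> real) \<Rightarrow> ('x \<Rightarrow> complex) \<Rightarrow> bool" where
  "bd_lipschitz_wrt Z Q \<phi> \<theta> \<equiv> lipschitz_gauge.bd_lipschitz Z (param_dist Q \<phi> \<theta>)"

lemma thin_if_bounded_lipschitz:
  fixes Z :: "'x set" and \<phi> :: "'x \<Rightarrow> 'e \<Rightarrow> complex" and f :: "'x \<Rightarrow> nat \<Rightarrow> nat \<Rightarrow> complex"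
  assumes Q: "finite Q" "card Q + 2 = n * m"
    and bound: "\<And>x e. x \<in> Z \<Longrightarrow> e \<in> Q \<Longrightarrow> cmod (\<phi> x e) \<le> N"
    and bound': "\<And>x. x \<in> Z \<Longrightarrow> \<bar>\<theta> x\<bar> \<le> N"
    and lip: "\<And>i j. i < n \<Longrightarrow> j < m \<Longrightarrow> bd_lipschitz_wrt Z Q \<phi> \<theta> (\<lambda>x. f x i j)"
  shows "thin n m (f ` Z)"
proof -
  interpret lipschitz_gauge Z "param_dist Q \<phi> \<theta>" by (rule lipschitz_gauge_param_dist)
  have "\<forall>i<n. \<forall>j<m. \<exists>K\<ge>0. \<forall>x\<in>Z. \<forall>y\<in>Z. cmod (f x i j - f y i j) \<le> K * param_dist Q \<phi> \<theta> x y"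
    using lip unfolding bd_lipschitz_def by blast
  then obtain K where K: "\<And>i j. i < n \<Longrightarrow> j < m \<Longrightarrow> 0 \<le> K i j"
    "\<And>i j x y. i < n \<Longrightarrow> j < m \<Longrightarrow> x \<in> Z \<Longrightarrow> y \<in> Z \<Longrightarrow>
       cmod (f x i j - f y i j) \<le> K i j * param_dist Q \<phi> \<theta> x y"
    by metis
  define L where "L = (\<Sum>i<n. \<Sum>j<m. K i j)"
  have KL: "K i j \<le> L" if "i < n" "j < m" for i j
  proof -
    have "K i j \<le> (\<Sum>j<m. K i j)" using K(1) that by (intro member_le_sum) auto
    also have "\<dots> \<le> L" unfolding L_def
      using K(1) that by (intro member_le_sum[where f = "\<lambda>i. \<Sum>j<m. K i j"] sum_nonneg) auto
    finally show ?thesis .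
  qed
  show ?thesis
  proof (rule thin_if_lipschitz_parametrised[OF Q bound bound'])
    fix x x' i j assume *: "x \<in> Z" "x' \<in> Z" "i < n" "j < m"
    have "K i j * param_dist Q \<phi> \<theta> x x' \<le> L * param_dist Q \<phi> \<theta> x x'"
      using KL * D_nonneg by (intro mult_right_mono) auto
    with K(2)[OF *(3,4,1,2)] show "cmod (f x i j - f x' i j) \<le> L * param_dist Q \<phi> \<theta> x x'" by linarith
  qed
qed

lemma bd_lipschitz_param:
  assumes "finite Q" "\<And>x. x \<in> Z \<Longrightarrow> cmod (\<phi> x e) \<le> N" "e \<in> Q"
  shows "bd_lipschitz_wrt Z Q \<phi> \<theta> (\<lambda>x. \<phi> x e)"
proof -
  interpret lipschitz_gauge Z "param_dist Q \<phi> \<theta>" by (rule lipschitz_gauge_param_dist)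
  show ?thesis
  proof (rule bd_lipschitzI[where K = N and L = 1])
    fix x y
    have "cmod (\<phi> x e - \<phi> y e) \<le> (\<Sum>e\<in>Q. cmod (\<phi> x e - \<phi> y e))"
      using assms by (intro member_le_sum[where f = "\<lambda>e. cmod (\<phi> x e - \<phi> y e)"]) auto
    then show "cmod (\<phi> x e - \<phi> y e) \<le> 1 * param_dist Q \<phi> \<theta> x y"
      by (simp add: param_dist_def)
  qed (use assms in auto)
qed

section \<open>Parameters for matrices with a double eigenvalue\<close>

definition mat_vec :: "nat \<Rightarrow> (nat \<Rightarrow> nat \<Rightarrow> complex) \<Rightarrow> (nat \<Rightarrow> complex) \<Rightarrow> nat \<Rightarrow> complex" where
  "mat_vec m A u i = (\<Sum>k<m. A i k * u k)"

text \<open>Two eigenvectors of \<open>A\<^sup>* A\<close> to the same eigenvalue, in reduced echelon form with pivots \<open>p\<close> and \<open>q\<close>. The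
normalisation makes the pair unique for a given plane of eigenvectors, so that \<open>u\<close> and \<open>v\<close> contribute exactly
\<open>2 (m - 2)\<close> complex parameters.\<close>

definition eigen_pair ::
  "nat \<Rightarrow> nat \<Rightarrow> nat \<Rightarrow> nat \<Rightarrow> (nat \<Rightarrow> nat \<Rightarrow> complex) \<Rightarrow>
     (nat \<Rightarrow> complex) \<Rightarrow> (nat \<Rightarrow> complex) \<Rightarrow> real \<Rightarrow> bool" where
  "eigen_pair n m p q A u v \<mu> \<longleftrightarrow>
     u p = 1 \<and> u q = 0 \<and> v p = 0 \<and> v q = 1 \<and>
     (\<forall>j<m. (\<Sum>i<n. cnj (A i j) * mat_vec m A u i) = \<mu> * u j) \<and>
     (\<forall>j<m. (\<Sum>i<n. cnj (A i j) * mat_vec m A v i) = \<mu> * v j)"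

text \<open>The \<open>2 \<times> 2\<close> minor, in the rows \<open>r\<close> and \<open>s\<close>, of the matrix with the columns \<open>A u\<close> and \<open>A v\<close>.\<close>

definition minor :: "nat \<Rightarrow> (nat \<Rightarrow> nat \<Rightarrow> complex) \<Rightarrow> (nat \<Rightarrow> complex) \<Rightarrow> (nat \<Rightarrow> complex) \<Rightarrow> nat \<Rightarrow> nat \<Rightarrow> complex"
  where "minor m A u v r s = mat_vec m A u r * mat_vec m A v s - mat_vec m A u s * mat_vec m A v r"

text \<open>The bounds make the reconstruction of \<open>A\<close> from its parameters Lipschitz: the minor and the squared length
of \<open>(y r, y s)\<close> are the denominators that occur.\<close>

definition independent_image_pairs :: "nat \<Rightarrow> nat \<Rightarrow> nat \<Rightarrow> nat \<Rightarrow> nat \<Rightarrow> nat \<Rightarrow> real \<Rightarrow>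
    ((nat \<Rightarrow> nat \<Rightarrow> complex) \<times> (nat \<Rightarrow> complex) \<times> (nat \<Rightarrow> complex) \<times> real) set" where
  "independent_image_pairs n m p q r s N = {(A, u, v, \<mu>). eigen_pair n m p q A u v \<mu> \<and>
     (\<forall>i<n. \<forall>j<m. cmod (A i j) \<le> N) \<and> (\<forall>j<m. cmod (u j) \<le> N \<and> cmod (v j) \<le> N) \<and>
     1 / N \<le> cmod (minor m A u v r s) \<and>
     1 / N \<le> (cmod (mat_vec m A u r))\<^sup>2 + (cmod (mat_vec m A u s))\<^sup>2}"

text \<open>Moving \<open>A\<close> across the inner product turns the eigenvalue equations into the Gram matrix of \<open>A u\<close>, \<open>A v\<close>.\<close>

lemma gram_transfer:
  "(\<Sum>i<n. cnj (mat_vec m A a i) * t i) = (\<Sum>k<m. cnj (a k) * (\<Sum>i<n. cnj (A i k) * t i))"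
proof -
  have "(\<Sum>i<n. cnj (mat_vec m A a i) * t i) = (\<Sum>i<n. \<Sum>k<m. cnj (a k) * (cnj (A i k) * t i))"
    by (simp add: mat_vec_def sum_distrib_right sum_distrib_left mult_ac)
  also have "\<dots> = (\<Sum>k<m. \<Sum>i<n. cnj (a k) * (cnj (A i k) * t i))" by (rule sum.swap)
  finally show ?thesis by (simp add: sum_distrib_left)
qed

lemma eigen_pair_inner:
  assumes "eigen_pair n m p q A u v \<mu>"
  shows "(\<Sum>i<n. cnj (mat_vec m A a i) * mat_vec m A u i) = \<mu> * (\<Sum>k<m. cnj (a k) * u k)"
    and "(\<Sum>i<n. cnj (mat_vec m A a i) * mat_vec m A v i) = \<mu> * (\<Sum>k<m. cnj (a k) * v k)"
  unfolding gram_transfer using assms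
  by (auto simp: eigen_pair_def sum_distrib_left mult_ac intro!: sum.cong)

lemma sum_split_two:
  fixes f :: "nat \<Rightarrow> complex"
  assumes "r < n" "s < n" "r \<noteq> s"
  shows "(\<Sum>i<n. f i) = f r + f s + (\<Sum>i\<in>{..<n} - {r, s}. f i)"
proof -
  have "(\<Sum>i<n. f i) = (\<Sum>i\<in>{r, s}. f i) + (\<Sum>i\<in>{..<n} - {r, s}. f i)"
    using assms by (subst sum.subset_diff[of "{r, s}"]) auto
  then show ?thesis using assms by simp
qed

lemma cmod_sum_norm_ge:
  fixes u :: "nat \<Rightarrow> complex"
  assumes "p < m" "u p = 1"
  shows "1 \<le> cmod (\<Sum>k<m. cnj (u k) * u k)"
proof -
  have "(\<Sum>k<m. cnj (u k) * u k) = of_real (\<Sum>k<m. (cmod (u k))\<^sup>2)"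
    unfolding of_real_sum by (intro sum.cong refl) (simp only: complex_norm_square mult.commute)
  moreover have "(cmod (u p))\<^sup>2 \<le> (\<Sum>k<m. (cmod (u k))\<^sup>2)"
    using assms by (intro member_le_sum[where f = "\<lambda>k. (cmod (u k))\<^sup>2"]) auto
  ultimately show ?thesis using assms by (simp del: of_real_sum of_real_power)
qed

text \<open>Lagrange's identity yields the modulus of the minor of \<open>y\<close> and \<open>z\<close> from their inner products, which are
known from the Gram matrix. So only the argument of the minor is left as a parameter: this is the one real
parameter among the complex ones.\<close>

lemma lagrange_identity_complex:
  fixes a b c d :: complex
  shows "(a * d - b * c) * cnj (a * d - b * c) =
    (a * cnj a + b * cnj b) * (cnj c * c + cnj d * d) - (cnj a * c + cnj b * d) * cnj (cnj a * c + cnj b * d)"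
  by (simp add: algebra_simps)

lemma mat_vec_bound:
  assumes "i < n" "\<And>i j. i < n \<Longrightarrow> j < m \<Longrightarrow> cmod (A i j) \<le> N" "\<And>j. j < m \<Longrightarrow> cmod (u j) \<le> N" 
  shows "cmod (mat_vec m A u i) \<le> m * (N * N)"
proof -
  have "cmod (mat_vec m A u i) \<le> (\<Sum>k<m. cmod (A i k * u k))" unfolding mat_vec_def by (rule norm_sum)
  also have "\<dots> \<le> card {..<m} * (N * N)"
  proof (rule sum_bounded_above)
    fix k assume k: "k \<in> {..<m}"
    have "0 \<le> N" using assms(3)[of k] k by (meson lessThan_iff norm_ge_zero order_trans)
    then show "cmod (A i k * u k) \<le> N * N" unfolding norm_mult using assms k by (intro mult_mono) auto
  qed
  finally show ?thesis by simp
qed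

lemma mat_vec_split:
  assumes "p < m" "q < m" "p \<noteq> q" 
  shows "mat_vec m A u i = A i p * u p + A i q * u q + (\<Sum>k\<in>{..<m} - {p, q}. A i k * u k)"
  unfolding mat_vec_def using assms by (rule sum_split_two)

text \<open>The parameters are arranged as an \<open>n \<times> m\<close> array: \<open>y = A u\<close> fills column \<open>p\<close>, and \<open>z = A v\<close> fills
column \<open>q\<close> except for the rows \<open>r\<close> and \<open>s\<close>. The other columns hold the entries of \<open>A\<close>, except
that the rows \<open>r\<close> and \<open>s\<close> hold \<open>u\<close> and \<open>v\<close> in their place. Together with the argument of the minor \<open>d\<close> this is
\<open>2 (nm - 2) + 1\<close> real parameters. From them one recovers in turn \<open>\<mu>\<close> (as the quotient of the squared norms of \<open>y\<close> and
\<open>u\<close>), the partial inner products of \<open>y\<close> and \<open>z\<close> over the rows \<open>r\<close>, \<open>s\<close>, the minor \<open>d\<close>, the entries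
\<open>z r\<close> and \<open>z s\<close>, the rows \<open>r\<close> and \<open>s\<close> of \<open>A\<close> (by Cramer's rule with determinant \<open>d\<close>), and finally the
columns \<open>p\<close> and \<open>q\<close>.\<close>

lemma thin_independent_image_pairs:
  assumes pq: "p < m" "q < m" "p \<noteq> q" and rs: "r < n" "s < n" "r \<noteq> s" and N: "0 < N"
  shows "thin n m (fst ` independent_image_pairs n m p q r s N)"
proof -
  define Z where "Z = independent_image_pairs n m p q r s N"
  define A :: "(nat \<Rightarrow> nat \<Rightarrow> complex) \<times> (nat \<Rightarrow> complex) \<times> (nat \<Rightarrow> complex) \<times> real \<Rightarrow> _"
    where "A = fst"
  define u :: "(nat \<Rightarrow> nat \<Rightarrow> complex) \<times> (nat \<Rightarrow> complex) \<times> (nat \<Rightarrow> complex) \<times> real \<Rightarrow> _"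
    where "u x = fst (snd x)" for x
  define v :: "(nat \<Rightarrow> nat \<Rightarrow> complex) \<times> (nat \<Rightarrow> complex) \<times> (nat \<Rightarrow> complex) \<times> real \<Rightarrow> _"
    where "v x = fst (snd (snd x))" for x
  define lam :: "(nat \<Rightarrow> nat \<Rightarrow> complex) \<times> (nat \<Rightarrow> complex) \<times> (nat \<Rightarrow> complex) \<times> real \<Rightarrow> complex"
    where "lam x = of_real (snd (snd (snd x)))" for x
  define y where "y x = mat_vec m (A x) (u x)" for x
  define z where "z x = mat_vec m (A x) (v x)" for x
  define d where "d x = y x r * z x s - y x s * z x r" for x
  define Q where "Q = {..<n} \<times> {..<m} - {(r, q), (s, q)}"
  define \<phi> where "\<phi> x e = (case e of (i, j) \<Rightarrow>
      if j = p then y x i else if j = q then z x i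
      else if i = r then u x j else if i = s then v x j else A x i j)" for x e
  define \<theta> where "\<theta> x = Arg (d x)" for x
  have ep: "eigen_pair n m p q (A x) (u x) (v x) (snd (snd (snd x)))" if "x \<in> Z" for x
    using that by (auto simp: Z_def independent_image_pairs_def A_def u_def v_def)
  have up: "u x p = 1" "u x q = 0" "v x p = 0" "v x q = 1" if "x \<in> Z" for x
    using ep[OF that] by (auto simp: eigen_pair_def)
  have eq_u: "(\<Sum>i<n. cnj (A x i j) * y x i) = lam x * u x j"
    and eq_v: "(\<Sum>i<n. cnj (A x i j) * z x i) = lam x * v x j" if "x \<in> Z" "j < m" for x j
    using ep[OF that(1)] that(2) by (auto simp: eigen_pair_def y_def z_def lam_def)
  have in_yy: "(\<Sum>i<n. cnj (y x i) * y x i) = lam x * (\<Sum>k<m. cnj (u x k) * u x k)"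
    and in_yz: "(\<Sum>i<n. cnj (y x i) * z x i) = lam x * (\<Sum>k<m. cnj (u x k) * v x k)"
    and in_zz: "(\<Sum>i<n. cnj (z x i) * z x i) = lam x * (\<Sum>k<m. cnj (v x k) * v x k)" if "x \<in> Z" for x
    unfolding y_def z_def lam_def using eigen_pair_inner[OF ep[OF that]] by auto
  have bA: "cmod (A x i j) \<le> N" if "x \<in> Z" "i < n" "j < m" for x i j
    using that by (auto simp: Z_def independent_image_pairs_def A_def)
  have bu: "cmod (u x j) \<le> N" and bv: "cmod (v x j) \<le> N" if "x \<in> Z" "j < m" for x j
    using that by (auto simp: Z_def independent_image_pairs_def u_def v_def)
  have bd: "1 / N \<le> cmod (d x)" and bY: "1 / N \<le> (cmod (y x r))\<^sup>2 + (cmod (y x s))\<^sup>2" if "x \<in> Z" for x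
    using that by (auto simp: Z_def independent_image_pairs_def minor_def d_def y_def z_def u_def v_def A_def)
  define N' where "N' = max pi (max N (m * (N * N)))"
  have by_z: "cmod (y x i) \<le> m * (N * N)" "cmod (z x i) \<le> m * (N * N)" if "x \<in> Z" "i < n" for x i
    unfolding y_def z_def by (rule mat_vec_bound[OF that(2) bA[OF that(1)]], assumption+,
      (rule bu[OF that(1)] bv[OF that(1)]), assumption)+
  have b\<phi>: "cmod (\<phi> x e) \<le> N'" if "x \<in> Z" "e \<in> Q" for x e
  proof -
    obtain i j where e: "e = (i, j)" "i < n" "j < m" using \<open>e \<in> Q\<close> by (auto simp: Q_def)
    show ?thesis
      using by_z[OF that(1) e(2)] bA[OF that(1) e(2,3)] bu[OF that(1) e(3)] bv[OF that(1) e(3)]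
      by (simp add: e(1) \<phi>_def N'_def le_max_iff_disj)
  qed
  have b\<theta>: "\<bar>\<theta> x\<bar> \<le> N'" for x
    using Arg_bounded[of "d x"] unfolding \<theta>_def N'_def by (auto simp: abs_le_iff le_max_iff_disj)
  have finQ: "finite Q" by (simp add: Q_def)
  have nm2: "{(r, q), (s, q)} \<subseteq> {..<n} \<times> {..<m}" using pq rs by auto
  have "card {(r, q), (s, q)} \<le> card ({..<n} \<times> {..<m})"
    by (intro card_mono nm2) auto
  moreover have "card {(r, q), (s, q)} = 2" using rs by simp
  ultimately have cQ: "card Q + 2 = n * m"
    using nm2 by (simp add: Q_def card_Diff_subset card_cartesian_product)
  interpret lipschitz_gauge Z "param_dist Q \<phi> \<theta>" by (rule lipschitz_gauge_param_dist)
  have par: "bd_lipschitz (\<lambda>x. \<phi> x e)" if "e \<in> Q" for e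
    using b\<phi> that by (intro bd_lipschitz_param[OF finQ, where N = N']) auto
  have y_b: "bd_lipschitz (\<lambda>x. y x i)" if "i < n" for i
    using par[of "(i, p)"] that pq unfolding \<phi>_def Q_def by auto
  have z_b': "bd_lipschitz (\<lambda>x. z x i)" if "i < n" "i \<noteq> r" "i \<noteq> s" for i
    using par[of "(i, q)"] that pq unfolding \<phi>_def Q_def by auto
  have A_b': "bd_lipschitz (\<lambda>x. A x i j)" if "i < n" "i \<noteq> r" "i \<noteq> s" "j < m" "j \<noteq> p" "j \<noteq> q" for i j
    using par[of "(i, j)"] that pq unfolding \<phi>_def Q_def by auto
  have u_b: "bd_lipschitz (\<lambda>x. u x j)" if "j < m" for j
  proof -
    consider "j = p" | "j = q" | "j \<noteq> p" "j \<noteq> q" by blast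
    then show ?thesis
    proof cases
      case 3 then show ?thesis using par[of "(r, j)"] that rs unfolding \<phi>_def Q_def by auto
    qed (auto intro: bd_lipschitz_cong[OF bd_lipschitz_const] simp: up)
  qed
  have v_b: "bd_lipschitz (\<lambda>x. v x j)" if "j < m" for j
  proof -
    consider "j = p" | "j = q" | "j \<noteq> p" "j \<noteq> q" by blast
    then show ?thesis
    proof cases
      case 3 then show ?thesis using par[of "(s, j)"] that rs unfolding \<phi>_def Q_def by auto
    qed (auto intro: bd_lipschitz_cong[OF bd_lipschitz_const] simp: up)
  qed
  have uu: "1 \<le> cmod (\<Sum>k<m. cnj (u x k) * u x k)" if "x \<in> Z" for x
    using cmod_sum_norm_ge[of p m "u x"] up[OF that] pq by auto
  have lam_b: "bd_lipschitz lam"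
  proof (rule bd_lipschitz_cong)
    show "bd_lipschitz (\<lambda>x. (\<Sum>i<n. cnj (y x i) * y x i) / (\<Sum>k<m. cnj (u x k) * u x k))"
      by (rule bd_lipschitz_divide[where c = 1]; (intro bd_lipschitz_sum bd_lipschitz_mult bd_lipschitz_cnj y_b u_b)?) (auto simp: uu)
    show "(\<Sum>i<n. cnj (y x i) * y x i) / (\<Sum>k<m. cnj (u x k) * u x k) = lam x" if "x \<in> Z" for x
    proof -
      have "(\<Sum>k<m. cnj (u x k) * u x k) \<noteq> 0" using uu[OF that] by auto
      then show ?thesis unfolding in_yy[OF that] by simp
    qed
  qed
  define R where "R = {..<n} - {r, s}"
  \<comment> \<open>the parts of \<open>\<langle>y, z\<rangle>\<close>, \<open>\<langle>z, z\<rangle>\<close> and \<open>\<langle>y, y\<rangle>\<close> that come from the rows \<open>r\<close> and \<open>s\<close>\<close>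
  define g where "g x = cnj (y x r) * z x r + cnj (y x s) * z x s" for x
  define h where "h x = cnj (z x r) * z x r + cnj (z x s) * z x s" for x
  define Y where "Y x = y x r * cnj (y x r) + y x s * cnj (y x s)" for x
  have Y_b: "bd_lipschitz Y" unfolding Y_def by (intro bd_lipschitz_add bd_lipschitz_mult bd_lipschitz_cnj y_b rs)
  have Y_norm: "1 / N \<le> cmod (Y x)" if "x \<in> Z" for x
  proof -
    have "Y x = of_real ((cmod (y x r))\<^sup>2 + (cmod (y x s))\<^sup>2)"
      by (simp only: Y_def of_real_add complex_norm_square)
    then have "cmod (Y x) = (cmod (y x r))\<^sup>2 + (cmod (y x s))\<^sup>2" by (simp del: of_real_add)
    with bY[OF that] show ?thesis by simp
  qed
  have g_b: "bd_lipschitz g"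
  proof (rule bd_lipschitz_cong)
    show "bd_lipschitz (\<lambda>x. lam x * (\<Sum>k<m. cnj (u x k) * v x k) - (\<Sum>i\<in>R. cnj (y x i) * z x i))"
      by (intro bd_lipschitz_diff bd_lipschitz_sum bd_lipschitz_mult bd_lipschitz_cnj y_b u_b v_b z_b' lam_b) (auto simp: R_def)
    show "lam x * (\<Sum>k<m. cnj (u x k) * v x k) - (\<Sum>i\<in>R. cnj (y x i) * z x i) = g x" if "x \<in> Z" for x
      using in_yz[OF that] unfolding sum_split_two[OF rs] g_def R_def by (simp add: algebra_simps)
  qed
  have h_b: "bd_lipschitz h"
  proof (rule bd_lipschitz_cong)
    show "bd_lipschitz (\<lambda>x. lam x * (\<Sum>k<m. cnj (v x k) * v x k) - (\<Sum>i\<in>R. cnj (z x i) * z x i))"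
      by (intro bd_lipschitz_diff bd_lipschitz_sum bd_lipschitz_mult bd_lipschitz_cnj y_b u_b v_b z_b' lam_b) (auto simp: R_def)
    show "lam x * (\<Sum>k<m. cnj (v x k) * v x k) - (\<Sum>i\<in>R. cnj (z x i) * z x i) = h x" if "x \<in> Z" for x
      using in_zz[OF that] unfolding sum_split_two[OF rs] h_def R_def by (simp add: algebra_simps)
  qed
  \<comment> \<open>Lagrange's identity gives \<open>\<bar>d\<bar>\<^sup>2\<close>, and \<open>\<theta>\<close> supplies the argument of \<open>d\<close>\<close>
  have "bd_lipschitz (\<lambda>x. of_real ((cmod (d x))\<^sup>2))"
  proof (rule bd_lipschitz_cong)
    show "bd_lipschitz (\<lambda>x. Y x * h x - g x * cnj (g x))"
      by (intro bd_lipschitz_diff bd_lipschitz_mult bd_lipschitz_cnj Y_b h_b g_b)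
    show "Y x * h x - g x * cnj (g x) = of_real ((cmod (d x))\<^sup>2)" for x
      unfolding complex_norm_square d_def lagrange_identity_complex Y_def h_def g_def by simp
  qed
  then have "bd_lipschitz (\<lambda>x. of_real (sqrt ((cmod (d x))\<^sup>2)))"
  proof (rule bd_lipschitz_sqrt)
    show "(1 / N)\<^sup>2 \<le> (cmod (d x))\<^sup>2" if "x \<in> Z" for x
      using bd[OF that] N by (intro power_mono) auto
  qed (use N in auto)
  then have cd_b: "bd_lipschitz (\<lambda>x. of_real (cmod (d x)))" by simp
  have cis_b: "bd_lipschitz (\<lambda>x. cis (\<theta> x))"
    by (rule bd_lipschitz_cis) (auto simp: param_dist_def intro!: sum_nonneg)
  have d_b: "bd_lipschitz d"
  proof (rule bd_lipschitz_cong)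
    show "bd_lipschitz (\<lambda>x. of_real (cmod (d x)) * cis (\<theta> x))" by (intro bd_lipschitz_mult cd_b cis_b)
    show "of_real (cmod (d x)) * cis (\<theta> x) = d x" for x
      using rcis_cmod_Arg[of "d x"] by (simp add: rcis_def \<theta>_def)
  qed
  have Y0: "Y x \<noteq> 0" and d0: "d x \<noteq> 0" if "x \<in> Z" for x
    using Y_norm[OF that] bd[OF that] N by (auto simp: zero_less_divide_iff not_le[symmetric])
  \<comment> \<open>\<open>g\<close> and \<open>d\<close> are linear in \<open>(z r, z s)\<close> with determinant \<open>Y\<close>\<close>
  have zr_b: "bd_lipschitz (\<lambda>x. z x r)"
  proof (rule bd_lipschitz_cong)
    show "bd_lipschitz (\<lambda>x. (y x r * g x - cnj (y x s) * d x) / Y x)"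
      using N by (intro bd_lipschitz_divide[where c = "1 / N"] bd_lipschitz_diff bd_lipschitz_mult bd_lipschitz_cnj Y_b g_b d_b y_b rs Y_norm) auto
    show "(y x r * g x - cnj (y x s) * d x) / Y x = z x r" if "x \<in> Z" for x
    proof -
      have "y x r * g x - cnj (y x s) * d x = z x r * Y x"
        unfolding g_def d_def Y_def by (simp add: algebra_simps)
      with Y0[OF that] show ?thesis by simp
    qed
  qed
  have zs_b: "bd_lipschitz (\<lambda>x. z x s)"
  proof (rule bd_lipschitz_cong)
    show "bd_lipschitz (\<lambda>x. (y x s * g x + cnj (y x r) * d x) / Y x)"
      using N by (intro bd_lipschitz_divide[where c = "1 / N"] bd_lipschitz_add bd_lipschitz_mult bd_lipschitz_cnj Y_b g_b d_b y_b rs Y_norm) auto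
    show "(y x s * g x + cnj (y x r) * d x) / Y x = z x s" if "x \<in> Z" for x
    proof -
      have "y x s * g x + cnj (y x r) * d x = z x s * Y x"
        unfolding g_def d_def Y_def by (simp add: algebra_simps)
      with Y0[OF that] show ?thesis by simp
    qed
  qed
  have z_b: "bd_lipschitz (\<lambda>x. z x i)" if "i < n" for i
    using zr_b zs_b z_b' that by blast
  \<comment> \<open>the eigenvalue equations in row \<open>j\<close>, with the known terms moved to the right-hand side\<close>
  define e1 where "e1 x j = lam x * u x j - (\<Sum>i\<in>R. cnj (A x i j) * y x i)" for x j
  define e2 where "e2 x j = lam x * v x j - (\<Sum>i\<in>R. cnj (A x i j) * z x i)" for x j
  have e1_b: "bd_lipschitz (\<lambda>x. e1 x j)" and e2_b: "bd_lipschitz (\<lambda>x. e2 x j)" if "j < m" "j \<noteq> p" "j \<noteq> q" for j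
    unfolding e1_def e2_def using that
    by (intro bd_lipschitz_diff bd_lipschitz_mult bd_lipschitz_sum bd_lipschitz_cnj lam_b u_b v_b A_b' y_b z_b; auto simp: R_def)+
  have e1: "cnj (A x r j) * y x r + cnj (A x s j) * y x s = e1 x j"
    and e2: "cnj (A x r j) * z x r + cnj (A x s j) * z x s = e2 x j" if "x \<in> Z" "j < m" for x j
    using eq_u[OF that] eq_v[OF that] unfolding sum_split_two[OF rs] e1_def e2_def R_def
    by (simp_all add: algebra_simps)
  have Ar_b: "bd_lipschitz (\<lambda>x. A x r j)" if j: "j < m" "j \<noteq> p" "j \<noteq> q" for j
  proof (rule bd_lipschitz_cong)
    show "bd_lipschitz (\<lambda>x. cnj ((e1 x j * z x s - e2 x j * y x s) / d x))"
      using N by (intro bd_lipschitz_cnj bd_lipschitz_divide[where c = "1 / N"] bd_lipschitz_diff bd_lipschitz_mult e1_b e2_b d_b y_b z_b rs j bd) auto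
    show "cnj ((e1 x j * z x s - e2 x j * y x s) / d x) = A x r j" if "x \<in> Z" for x
    proof -
      have "e1 x j * z x s - e2 x j * y x s = cnj (A x r j) * d x"
        unfolding e1[OF that j(1), symmetric] e2[OF that j(1), symmetric] d_def by (simp add: algebra_simps)
      with d0[OF that] show ?thesis by simp
    qed
  qed
  have As_b: "bd_lipschitz (\<lambda>x. A x s j)" if j: "j < m" "j \<noteq> p" "j \<noteq> q" for j
  proof (rule bd_lipschitz_cong)
    show "bd_lipschitz (\<lambda>x. cnj ((e2 x j * y x r - e1 x j * z x r) / d x))"
      using N by (intro bd_lipschitz_cnj bd_lipschitz_divide[where c = "1 / N"] bd_lipschitz_diff bd_lipschitz_mult e1_b e2_b d_b y_b z_b rs j bd) auto
    show "cnj ((e2 x j * y x r - e1 x j * z x r) / d x) = A x s j" if "x \<in> Z" for x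
    proof -
      have "e2 x j * y x r - e1 x j * z x r = cnj (A x s j) * d x"
        unfolding e1[OF that j(1), symmetric] e2[OF that j(1), symmetric] d_def by (simp add: algebra_simps)
      with d0[OF that] show ?thesis by simp
    qed
  qed
  have A_b1: "bd_lipschitz (\<lambda>x. A x i j)" if "i < n" "j < m" "j \<noteq> p" "j \<noteq> q" for i j
    using that Ar_b As_b A_b' by blast
  have A_p: "bd_lipschitz (\<lambda>x. A x i p)" if "i < n" for i
  proof (rule bd_lipschitz_cong)
    show "bd_lipschitz (\<lambda>x. y x i - (\<Sum>k\<in>{..<m} - {p, q}. A x i k * u x k))"
      using that by (intro bd_lipschitz_diff bd_lipschitz_sum bd_lipschitz_mult y_b u_b A_b1) auto
  qed (simp add: y_def mat_vec_split[OF pq] up)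
  have A_q: "bd_lipschitz (\<lambda>x. A x i q)" if "i < n" for i
  proof (rule bd_lipschitz_cong)
    show "bd_lipschitz (\<lambda>x. z x i - (\<Sum>k\<in>{..<m} - {p, q}. A x i k * v x k))"
      using that by (intro bd_lipschitz_diff bd_lipschitz_sum bd_lipschitz_mult z_b v_b A_b1) auto
  qed (simp add: z_def mat_vec_split[OF pq] up)
  have "bd_lipschitz (\<lambda>x. A x i j)" if "i < n" "j < m" for i j
    using that A_p A_q A_b1 by blast
  then have "thin n m (A ` Z)"
    by (intro thin_if_bounded_lipschitz[OF finQ cQ b\<phi> b\<theta>]) auto
  then show ?thesis unfolding A_def Z_def .
qed

text \<open>The case of eigenvalue \<open>0\<close>, where the eigenvectors lie in the kernel of \<open>A\<close>.\<close>

definition null_pairs :: "nat \<Rightarrow> nat \<Rightarrow> nat \<Rightarrow> nat \<Rightarrow> real \<Rightarrow>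
    ((nat \<Rightarrow> nat \<Rightarrow> complex) \<times> (nat \<Rightarrow> complex) \<times> (nat \<Rightarrow> complex)) set" where
  "null_pairs n m p q N = {(A, u, v). u p = 1 \<and> u q = 0 \<and> v p = 0 \<and> v q = 1 \<and>
     (\<forall>i<n. mat_vec m A u i = 0 \<and> mat_vec m A v i = 0) \<and>
     (\<forall>i<n. \<forall>j<m. cmod (A i j) \<le> N) \<and> (\<forall>j<m. cmod (u j) \<le> N \<and> cmod (v j) \<le> N)}"

text \<open>Here the columns \<open>p\<close> and \<open>q\<close> are linear combinations of the others, with coefficients from \<open>u\<close> and \<open>v\<close>. Since
\<open>m \<le> n\<close>, the free entries of \<open>u\<close> and \<open>v\<close> fit into these two columns of the parameter array. The real
parameter and the remaining positions of the two columns are filled with constants or with the pivot entries.\<close>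

lemma thin_null_pairs:
  assumes pq: "p < m" "q < m" "p \<noteq> q" and mn: "m \<le> n"
  shows "thin n m (fst ` null_pairs n m p q N)"
proof -
  define Z where "Z = null_pairs n m p q N"
  define A :: "(nat \<Rightarrow> nat \<Rightarrow> complex) \<times> (nat \<Rightarrow> complex) \<times> (nat \<Rightarrow> complex) \<Rightarrow> _"
    where "A = fst"
  define u :: "(nat \<Rightarrow> nat \<Rightarrow> complex) \<times> (nat \<Rightarrow> complex) \<times> (nat \<Rightarrow> complex) \<Rightarrow> _"
    where "u x = fst (snd x)" for x
  define v :: "(nat \<Rightarrow> nat \<Rightarrow> complex) \<times> (nat \<Rightarrow> complex) \<times> (nat \<Rightarrow> complex) \<Rightarrow> _"
    where "v x = snd (snd x)" for x
  define Q where "Q = {..<n} \<times> {..<m} - {(p, q), (q, q)}"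
  define \<phi> where "\<phi> x e = (case e of (i, j) \<Rightarrow>
      if j = p then (if i < m then u x i else 0) else if j = q then (if i < m then v x i else 0)
      else A x i j)" for x e
  define \<theta> :: "(nat \<Rightarrow> nat \<Rightarrow> complex) \<times> (nat \<Rightarrow> complex) \<times> (nat \<Rightarrow> complex) \<Rightarrow> real" where "\<theta> x = 0" for x
  have up: "u x p = 1" "u x q = 0" "v x p = 0" "v x q = 1" if "x \<in> Z" for x
    using that by (auto simp: Z_def null_pairs_def u_def v_def)
  have ker: "mat_vec m (A x) (u x) i = 0" "mat_vec m (A x) (v x) i = 0" if "x \<in> Z" "i < n" for x i
    using that by (auto simp: Z_def null_pairs_def u_def v_def A_def)
  have bA: "cmod (A x i j) \<le> max 0 N" if "x \<in> Z" "i < n" "j < m" for x i j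
    using that by (auto simp: Z_def null_pairs_def A_def le_max_iff_disj)
  have bu: "cmod (u x j) \<le> max 0 N" and bv: "cmod (v x j) \<le> max 0 N" if "x \<in> Z" "j < m" for x j
    using that by (auto simp: Z_def null_pairs_def u_def v_def le_max_iff_disj)
  have b\<phi>: "cmod (\<phi> x e) \<le> max 0 N" if "x \<in> Z" "e \<in> Q" for x e
  proof -
    obtain i j where e: "e = (i, j)" "i < n" "j < m" using \<open>e \<in> Q\<close> by (auto simp: Q_def)
    show ?thesis
      using bA[OF that(1) e(2,3)] bu[OF that(1), of i] bv[OF that(1), of i]
      by (simp add: e(1) \<phi>_def)
  qed
  have b\<theta>: "\<bar>\<theta> x\<bar> \<le> max 0 N" for x by (simp add: \<theta>_def)
  have finQ: "finite Q" by (simp add: Q_def)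
  have nm2: "{(p, q), (q, q)} \<subseteq> {..<n} \<times> {..<m}" using pq mn by auto
  have "card {(p, q), (q, q)} \<le> card ({..<n} \<times> {..<m})"
    by (intro card_mono nm2) auto
  moreover have "card {(p, q), (q, q)} = 2" using pq by simp
  ultimately have cQ: "card Q + 2 = n * m"
    using nm2 by (simp add: Q_def card_Diff_subset card_cartesian_product)
  interpret lipschitz_gauge Z "param_dist Q \<phi> \<theta>" by (rule lipschitz_gauge_param_dist)
  have par: "bd_lipschitz (\<lambda>x. \<phi> x e)" if "e \<in> Q" for e
    using b\<phi> that by (intro bd_lipschitz_param[OF finQ, where N = "max 0 N"]) auto
  have A_b1: "bd_lipschitz (\<lambda>x. A x i j)" if "i < n" "j < m" "j \<noteq> p" "j \<noteq> q" for i j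
    using par[of "(i, j)"] that pq unfolding \<phi>_def Q_def by auto
  have u_b: "bd_lipschitz (\<lambda>x. u x j)" if "j < m" "j \<noteq> p" "j \<noteq> q" for j
    using par[of "(j, p)"] that pq mn unfolding \<phi>_def Q_def by auto
  have v_b: "bd_lipschitz (\<lambda>x. v x j)" if "j < m" "j \<noteq> p" "j \<noteq> q" for j
    using par[of "(j, q)"] that pq mn unfolding \<phi>_def Q_def by auto
  have A_p: "bd_lipschitz (\<lambda>x. A x i p)" if "i < n" for i
  proof (rule bd_lipschitz_cong)
    show "bd_lipschitz (\<lambda>x. 0 - (\<Sum>k\<in>{..<m} - {p, q}. A x i k * u x k))"
      using that by (intro bd_lipschitz_diff bd_lipschitz_sum bd_lipschitz_mult bd_lipschitz_const u_b A_b1) auto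
    fix x assume x: "x \<in> Z"
    show "0 - (\<Sum>k\<in>{..<m} - {p, q}. A x i k * u x k) = A x i p"
      using ker(1)[OF x that] unfolding mat_vec_split[OF pq] by (simp add: up[OF x] neg_eq_iff_add_eq_0 add.commute)
  qed
  have A_q: "bd_lipschitz (\<lambda>x. A x i q)" if "i < n" for i
  proof (rule bd_lipschitz_cong)
    show "bd_lipschitz (\<lambda>x. 0 - (\<Sum>k\<in>{..<m} - {p, q}. A x i k * v x k))"
      using that by (intro bd_lipschitz_diff bd_lipschitz_sum bd_lipschitz_mult bd_lipschitz_const v_b A_b1) auto
    fix x assume x: "x \<in> Z"
    show "0 - (\<Sum>k\<in>{..<m} - {p, q}. A x i k * v x k) = A x i q"
      using ker(2)[OF x that] unfolding mat_vec_split[OF pq] by (simp add: up[OF x] neg_eq_iff_add_eq_0 add.commute)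
  qed
  have "bd_lipschitz (\<lambda>x. A x i j)" if "i < n" "j < m" for i j
    using that A_p A_q A_b1 by blast
  then have "thin n m (A ` Z)"
    by (intro thin_if_bounded_lipschitz[OF finQ cQ b\<phi> b\<theta>]) auto
  then show ?thesis unfolding A_def Z_def .
qed

section \<open>Eigenvectors of a double eigenvalue\<close>

lemma mat_mult_entry:
  assumes "A \<in> carrier_mat a b" "B \<in> carrier_mat b c" "i < a" "j < c"
  shows "(A * B) $$ (i, j) = (\<Sum>k<b. A $$ (i, k) * B $$ (k, j))"
  using assms by (auto simp: scalar_prod_def lessThan_atLeast0 intro!: sum.cong)

lemma mat_adjoint_mult_entry:
  fixes B :: "complex mat"
  assumes "B \<in> carrier_mat n m" "a < m" "b < m"
  shows "(mat_adjoint B * B) $$ (a, b) = (\<Sum>i<n. cnj (B $$ (i, a)) * B $$ (i, b))"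
  using assms by (auto simp: mat_adjoint_def scalar_prod_def lessThan_atLeast0 mat_of_rows_index intro!: sum.cong)

lemma prod_lessThan_split_two:
  fixes f :: "nat \<Rightarrow> 'b::comm_monoid_mult"
  assumes "i < m" "j < m" "i \<noteq> j"
  shows "\<exists>ks. length ks + 2 = m \<and> (\<Prod>k<m. f k) = (\<Prod>k\<leftarrow>i # j # ks. f k)"
proof -
  define ks where "ks = filter (\<lambda>k. k \<noteq> i \<and> k \<noteq> j) [0..<m]"
  have d: "distinct (i # j # ks)" using assms by (auto simp: ks_def)
  have s: "set (i # j # ks) = {..<m}" using assms by (auto simp: ks_def)
  have "length (i # j # ks) = m" using distinct_card[OF d] s by simp
  moreover have "(\<Prod>k<m. f k) = (\<Prod>k\<leftarrow>i # j # ks. f k)"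
    using prod.distinct_set_conv_list[OF d, of f] s by simp
  ultimately show ?thesis by auto
qed

text \<open>In a Schur form that starts with the double eigenvalue \<open>c\<close>, the first column \<open>f\<close> of the basis is an eigenvector,
and \<open>w = (X - c) g\<close> is a multiple of \<open>f\<close> for the second column \<open>g\<close>. As \<open>X - c\<close> is Hermitian and annihilates \<open>f\<close>,
the vectors \<open>w\<close> and \<open>f\<close> are orthogonal; so \<open>w = 0\<close> and \<open>g\<close> is an eigenvector too.\<close>

lemma double_eigenvalue_eigenvectors:
  fixes X :: "complex mat"
  assumes X: "X \<in> carrier_mat m m"
    and herm: "\<And>a b. a < m \<Longrightarrow> b < m \<Longrightarrow> X $$ (a, b) = cnj (X $$ (b, a))"
    and ev: "char_poly X = (\<Prod>i<m. [:- complex_of_real (l i), 1:])"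
    and ij: "i < m" "j < m" "i \<noteq> j" "l i = l j"
  obtains f g p q where "\<And>a. a < m \<Longrightarrow> (\<Sum>b<m. X $$ (a, b) * f b) = of_real (l i) * f a"
    "\<And>a. a < m \<Longrightarrow> (\<Sum>b<m. X $$ (a, b) * g b) = of_real (l i) * g a"
    "p < m" "q < m" "f p * g q \<noteq> f q * g p"
proof -
  define c where "c = complex_of_real (l i)"
  obtain ks where ks: "length ks + 2 = m"
    "(\<Prod>k<m. [:- complex_of_real (l k), 1:]) = (\<Prod>k\<leftarrow>i # j # ks. [:- complex_of_real (l k), 1:])"
    using prod_lessThan_split_two[OF ij(1-3)] by metis
  define es where "es = map (\<lambda>k. complex_of_real (l k)) (i # j # ks)"
  have "char_poly X = (\<Prod>e\<leftarrow>es. [:- e, 1:])"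
    unfolding ev ks(2) es_def map_map comp_def ..
  moreover obtain T P Q where "schur_decomposition X es = (T, P, Q)"
    by (cases "schur_decomposition X es")
  ultimately have sim: "similar_mat_wit X T P Q" and ut: "upper_triangular T" and diag: "diag_mat T = es"
    using schur_decomposition[OF X] by auto
  have car: "T \<in> carrier_mat m m" "P \<in> carrier_mat m m" "Q \<in> carrier_mat m m"
    and PQ: "Q * P = 1\<^sub>m m" and XPTQ: "X = P * T * Q"
    using similar_mat_witD2[OF X sim] by auto
  have XP: "X * P = P * T"
    using car PQ unfolding XPTQ by (simp add: assoc_mult_mat[of _ m m _ m _ m])
  have m2: "0 < m" "1 < m" using ks(1) by auto
  have "diag_mat T ! 0 = c" "diag_mat T ! 1 = c"
    unfolding diag es_def c_def using ij by auto
  then have T00: "T $$ (0, 0) = c" and T11: "T $$ (1, 1) = c"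
    using car(1) m2 by (auto simp: diag_mat_def)
  have Tz: "T $$ (k, k') = 0" if "k < m" "k' < k" for k k'
    using ut car(1) that by (auto simp: upper_triangular_def)
  define f where "f a = P $$ (a, 0)" for a
  define g where "g a = P $$ (a, 1)" for a
  have f: "(\<Sum>b<m. X $$ (a, b) * f b) = c * f a" if "a < m" for a
  proof -
    have "(\<Sum>b<m. X $$ (a, b) * f b) = (\<Sum>k<m. P $$ (a, k) * T $$ (k, 0))"
      using mat_mult_entry[OF X car(2) that m2(1)] mat_mult_entry[OF car(2) car(1) that m2(1)]
      unfolding XP f_def by simp
    also have "\<dots> = (\<Sum>k\<in>{0}. P $$ (a, k) * T $$ (k, 0))"
      using m2 Tz by (intro sum.mono_neutral_right) auto
    finally show ?thesis by (simp add: T00 f_def)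
  qed
  have g1: "(\<Sum>b<m. X $$ (a, b) * g b) - c * g a = T $$ (0, 1) * f a" if "a < m" for a
  proof -
    have "(\<Sum>b<m. X $$ (a, b) * g b) = (\<Sum>k<m. P $$ (a, k) * T $$ (k, 1))"
      using mat_mult_entry[OF X car(2) that m2(2)] mat_mult_entry[OF car(2) car(1) that m2(2)]
      unfolding XP g_def by simp
    also have "\<dots> = (\<Sum>k\<in>{0, 1}. P $$ (a, k) * T $$ (k, 1))"
      using m2 Tz by (intro sum.mono_neutral_right) auto
    finally show ?thesis by (simp add: T11 f_def g_def del: One_nat_def)
  qed
  have fc: "(\<Sum>b<m. cnj (X $$ (b, a)) * f b) = c * f a" if "a < m" for a
  proof -
    have "(\<Sum>b<m. cnj (X $$ (b, a)) * f b) = (\<Sum>b<m. X $$ (a, b) * f b)"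
      by (intro sum.cong refl) (simp add: herm[OF that, symmetric])
    then show ?thesis using f[OF that] by simp
  qed
  define w where "w a = (\<Sum>b<m. X $$ (a, b) * g b) - c * g a" for a
  have "(\<Sum>a<m. cnj (w a) * f a) =
      (\<Sum>a<m. (\<Sum>b<m. cnj (X $$ (a, b)) * cnj (g b)) * f a) - c * (\<Sum>a<m. cnj (g a) * f a)"
    unfolding w_def by (simp add: c_def left_diff_distrib right_diff_distrib sum_subtractf sum_distrib_left mult_ac)
  also have "(\<Sum>a<m. (\<Sum>b<m. cnj (X $$ (a, b)) * cnj (g b)) * f a) =
      (\<Sum>a<m. \<Sum>b<m. cnj (g b) * (cnj (X $$ (a, b)) * f a))"
    by (simp add: sum_distrib_left mult_ac)
  also have "\<dots> = (\<Sum>b<m. \<Sum>a<m. cnj (g b) * (cnj (X $$ (a, b)) * f a))" by (rule sum.swap)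
  also have "\<dots> = (\<Sum>b<m. cnj (g b) * (c * f b))"
    by (intro sum.cong refl) (simp only: lessThan_iff fc sum_distrib_left[symmetric])
  also have "\<dots> - c * (\<Sum>a<m. cnj (g a) * f a) = 0"
    by (simp add: sum_distrib_left mult_ac)
  finally have wf: "(\<Sum>a<m. cnj (w a) * f a) = 0" .
  have "(\<Sum>a<m. cnj (w a) * w a) = 0"
  proof -
    have "(\<Sum>a<m. cnj (w a) * w a) = (\<Sum>a<m. T $$ (0, 1) * (cnj (w a) * f a))"
      using g1 by (intro sum.cong refl) (simp add: w_def mult.left_commute)
    then show ?thesis
      using wf by (simp flip: sum_distrib_left)
  qed
  moreover have "(\<Sum>a<m. cnj (w a) * w a) = of_real (\<Sum>a<m. (cmod (w a))\<^sup>2)"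
    unfolding of_real_sum by (intro sum.cong refl) (simp only: complex_norm_square mult.commute)
  ultimately have "(\<Sum>a<m. (cmod (w a))\<^sup>2) = 0" by (metis of_real_eq_0_iff)
  then have "w a = 0" if "a < m" for a
    using that by (subst (asm) sum_nonneg_eq_0_iff) auto
  then have g: "(\<Sum>b<m. X $$ (a, b) * g b) = c * g a" if "a < m" for a
    using that by (simp add: w_def)
  have QP: "(\<Sum>a<m. Q $$ (k, a) * P $$ (a, k')) = (if k = k' then 1 else 0)" if "k < m" "k' < m" for k k'
    using mat_mult_entry[OF car(3,2) that] that unfolding PQ by simp
  \<comment> \<open>if all \<open>2 \<times> 2\<close> minors of \<open>f\<close>, \<open>g\<close> vanished, then so would the leading one of \<open>Q * P = 1\<close>\<close>
  have "\<exists>p<m. \<exists>q<m. f p * g q \<noteq> f q * g p"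
  proof (rule ccontr)
    assume "\<not> ?thesis"
    then have *: "f p * g q = f q * g p" if "p < m" "q < m" for p q using that by blast
    have "(1::complex) = (\<Sum>p<m. Q $$ (0, p) * f p) * (\<Sum>q<m. Q $$ (1, q) * g q)"
      using QP m2 by (simp add: f_def g_def)
    also have "\<dots> = (\<Sum>p<m. \<Sum>q<m. Q $$ (0, p) * Q $$ (1, q) * (f p * g q))"
      by (simp add: sum_product mult_ac)
    also have "\<dots> = (\<Sum>p<m. \<Sum>q<m. Q $$ (0, p) * Q $$ (1, q) * (f q * g p))"
      using * by (intro sum.cong) auto
    also have "\<dots> = (\<Sum>p<m. Q $$ (0, p) * g p) * (\<Sum>q<m. Q $$ (1, q) * f q)"
      by (simp add: sum_product mult_ac)
    also have "\<dots> = 0" using QP m2 by (simp add: f_def g_def)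
    finally show False by simp
  qed
  then show ?thesis using that f g unfolding c_def by blast
qed

text \<open>Cramer's rule with the nonzero minor in the rows \<open>p\<close>, \<open>q\<close> brings the two eigenvectors into echelon form.\<close>

lemma double_eigenvalue_eigen_pair:
  fixes B :: "complex mat"
  assumes B: "B \<in> carrier_mat n m"
    and ev: "lists_eigenvalues (mat_adjoint B * B) l"
    and ij: "i < m" "j < m" "i \<noteq> j" "l i = l j"
  obtains p q u v where "p < m" "q < m" "p \<noteq> q"
    "eigen_pair n m p q (\<lambda>i j. B $$ (i, j)) u v (l i)"
proof -
  define X where "X = mat_adjoint B * B"
  define A where "A i j = B $$ (i, j)" for i j
  have dimX: "dim_row X = m" "dim_col X = m"
    using B by (auto simp: X_def mat_adjoint_def)
  then have X: "X \<in> carrier_mat m m" by auto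
  have Xe: "X $$ (a, b) = (\<Sum>i<n. cnj (A i a) * A i b)" if "a < m" "b < m" for a b
    unfolding X_def A_def using mat_adjoint_mult_entry[OF B that] .
  have herm: "X $$ (a, b) = cnj (X $$ (b, a))" if "a < m" "b < m" for a b
    using that by (simp add: Xe mult.commute)
  have cp: "char_poly X = (\<Prod>i<m. [:- complex_of_real (l i), 1:])"
    using ev dimX unfolding lists_eigenvalues_def X_def[symmetric] by simp
  obtain f g p q where fg: "\<And>a. a < m \<Longrightarrow> (\<Sum>b<m. X $$ (a, b) * f b) = of_real (l i) * f a"
    "\<And>a. a < m \<Longrightarrow> (\<Sum>b<m. X $$ (a, b) * g b) = of_real (l i) * g a"
    and pq: "p < m" "q < m" "f p * g q \<noteq> f q * g p"
    using double_eigenvalue_eigenvectors[OF X herm cp ij] by blast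
  define d where "d = f p * g q - f q * g p"
  have d0: "d \<noteq> 0" using pq(3) by (simp add: d_def)
  define u where "u k = (g q / d) * f k - (f q / d) * g k" for k
  define v where "v k = (f p / d) * g k - (g p / d) * f k" for k
  have comb: "(\<Sum>b<m. X $$ (a, b) * (s * f b - t * g b)) = of_real (l i) * (s * f a - t * g a)"
    if "a < m" for a s t
  proof -
    have "(\<Sum>b<m. X $$ (a, b) * (s * f b - t * g b)) =
        s * (\<Sum>b<m. X $$ (a, b) * f b) - t * (\<Sum>b<m. X $$ (a, b) * g b)"
      by (simp add: right_diff_distrib sum_subtractf sum_distrib_left mult_ac)
    then show ?thesis using fg[OF that] by (simp add: algebra_simps)
  qed
  have eu: "(\<Sum>b<m. X $$ (a, b) * u b) = of_real (l i) * u a" if "a < m" for a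
    unfolding u_def by (rule comb[OF that])
  have ev': "(\<Sum>b<m. X $$ (a, b) * v b) = of_real (l i) * v a" if "a < m" for a
    using comb[OF that, of "- (g p / d)" "- (f p / d)"] unfolding v_def by (simp add: algebra_simps)
  have tr: "(\<Sum>i<n. cnj (A i a) * mat_vec m A w i) = (\<Sum>b<m. X $$ (a, b) * w b)" if "a < m" for a w
  proof -
    have "(\<Sum>i<n. cnj (A i a) * mat_vec m A w i) = (\<Sum>i<n. \<Sum>b<m. cnj (A i a) * A i b * w b)"
      by (simp add: mat_vec_def sum_distrib_left mult_ac)
    also have "\<dots> = (\<Sum>b<m. \<Sum>i<n. cnj (A i a) * A i b * w b)" by (rule sum.swap)
    finally show ?thesis using that by (simp add: Xe sum_distrib_right)
  qed
  have "u p = 1" "u q = 0" "v p = 0" "v q = 1"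
  proof -
    have "u k = (f k * g q - f q * g k) / d" "v k = (f p * g k - f k * g p) / d" for k
      by (simp_all add: u_def v_def diff_divide_distrib mult.commute)
    then show "u p = 1" "u q = 0" "v p = 0" "v q = 1" using d0 by (simp_all add: d_def)
  qed
  then have "eigen_pair n m p q A u v (l i)"
    unfolding eigen_pair_def using eu ev' tr by simp
  moreover have "p \<noteq> q" using pq(3) by auto
  ultimately show ?thesis using that pq unfolding A_def by blast
qed

text \<open>For \<open>\<mu> \<noteq> 0\<close> some minor of \<open>A u\<close> and \<open>A v\<close> is nonzero: otherwise \<open>A v = \<kappa> A u\<close>, hence \<open>\<mu> v = \<kappa> \<mu> u\<close>, which fails
at the pivot \<open>q\<close>. A large natural number then satisfies all bounds at once.\<close>

lemma eigen_pair_cases: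
  fixes A :: "nat \<Rightarrow> nat \<Rightarrow> complex"
  assumes ep: "eigen_pair n m p q A u v \<mu>" and pq: "p < m" "q < m"
  shows "(\<exists>r<n. \<exists>s<n. r \<noteq> s \<and> (\<exists>N::nat. 0 < N \<and> A \<in> fst ` independent_image_pairs n m p q r s N)) \<or>
         (\<exists>N::nat. A \<in> fst ` null_pairs n m p q N)"
proof -
  define y where "y = mat_vec m A u"
  define z where "z = mat_vec m A v"
  have up: "u p = 1" "u q = 0" "v p = 0" "v q = 1" using ep by (auto simp: eigen_pair_def)
  define K where "K = (\<Sum>i<n. \<Sum>j<m. cmod (A i j)) + (\<Sum>j<m. cmod (u j)) + (\<Sum>j<m. cmod (v j))"
  have bA: "cmod (A i j) \<le> K" if "i < n" "j < m" for i j
  proof -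
    have "cmod (A i j) \<le> (\<Sum>j<m. cmod (A i j))" using that by (intro member_le_sum) auto
    also have "\<dots> \<le> (\<Sum>i<n. \<Sum>j<m. cmod (A i j))"
      using that by (intro member_le_sum[where f = "\<lambda>i. \<Sum>j<m. cmod (A i j)"] sum_nonneg) auto
    also have "\<dots> \<le> K" unfolding K_def by (simp add: sum_nonneg add_nonneg_nonneg add.assoc)
    finally show ?thesis .
  qed
  have bu: "cmod (u j) \<le> K" if "j < m" for j
  proof -
    have "cmod (u j) \<le> (\<Sum>j<m. cmod (u j))"
      using that by (intro member_le_sum[where f = "\<lambda>j. cmod (u j)"]) auto
    also have "\<dots> \<le> K" unfolding K_def by (simp add: sum_nonneg)
    finally show ?thesis .
  qed
  have bv: "cmod (v j) \<le> K" if "j < m" for j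
  proof -
    have "cmod (v j) \<le> (\<Sum>j<m. cmod (v j))"
      using that by (intro member_le_sum[where f = "\<lambda>j. cmod (v j)"]) auto
    also have "\<dots> \<le> K" unfolding K_def by (simp add: sum_nonneg)
    finally show ?thesis .
  qed
  have of_norm: "(\<Sum>i<n. cnj (w i) * w i) = of_real (\<Sum>i<n. (cmod (w i))\<^sup>2)" for w
    unfolding of_real_sum by (intro sum.cong refl) (simp only: complex_norm_square mult.commute)
  have null: "w i = 0" if "(\<Sum>i<n. cnj (w i) * w i) = 0" "i < n" for w i
  proof -
    have "(\<Sum>i<n. (cmod (w i))\<^sup>2) = 0" using that(1) unfolding of_norm by (metis of_real_eq_0_iff)
    then show ?thesis using that(2) by (subst (asm) sum_nonneg_eq_0_iff) auto
  qed
  show ?thesis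
  proof (cases "\<mu> = 0")
    case True
    obtain N :: nat where "K \<le> N" using real_arch_simple by blast
    moreover have "y i = 0" "z i = 0" if "i < n" for i
      using null[OF _ that] eigen_pair_inner[OF ep] True unfolding y_def z_def by auto
    ultimately have "(A, u, v) \<in> null_pairs n m p q N"
      using bA bu bv up unfolding null_pairs_def y_def z_def by (auto intro!: order_trans[OF bA] order_trans[OF bu] order_trans[OF bv])
    then have "A \<in> fst ` null_pairs n m p q N" by (rule image_eqI[rotated]) simp
    then show ?thesis by blast
  next
    case False
    have "\<exists>r<n. \<exists>s<n. minor m A u v r s \<noteq> 0"
    proof (rule ccontr)
      assume "\<not> ?thesis"
      then have *: "y r * z s = y s * z r" if "r < n" "s < n" for r s
        using that unfolding minor_def y_def z_def by auto
      have "(\<Sum>k<m. cnj (u k) * u k) \<noteq> 0"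
        using cmod_sum_norm_ge[of p m u] pq up by auto
      then have "(\<Sum>i<n. cnj (y i) * y i) \<noteq> 0"
        using eigen_pair_inner(1)[OF ep, of u] False unfolding y_def by simp
      then obtain r where r: "r < n" "y r \<noteq> 0"
        by (metis (no_types, lifting) lessThan_iff mult_zero_right sum.neutral)
      define \<kappa> where "\<kappa> = z r / y r"
      have zs: "z s = \<kappa> * y s" if "s < n" for s
        using *[OF r(1) that] r(2) by (simp add: \<kappa>_def field_simps)
      have "\<mu> * v q = (\<Sum>i<n. cnj (A i q) * z i)"
        using ep pq unfolding eigen_pair_def z_def by auto
      also have "\<dots> = (\<Sum>i<n. \<kappa> * (cnj (A i q) * y i))"
        by (intro sum.cong refl) (simp only: zs lessThan_iff mult_ac)
      also have "\<dots> = \<kappa> * (\<mu> * u q)"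
        using ep pq unfolding eigen_pair_def y_def by (simp flip: sum_distrib_left)
      finally show False using up False by simp
    qed
    then obtain r s where rs: "r < n" "s < n" "minor m A u v r s \<noteq> 0" by blast
    then have "r \<noteq> s" by (auto simp: minor_def)
    have "y r \<noteq> 0 \<or> y s \<noteq> 0" using rs(3) by (auto simp: minor_def y_def)
    then have Ypos: "0 < (cmod (y r))\<^sup>2 + (cmod (y s))\<^sup>2" by (simp add: sum_power2_gt_zero_iff)
    obtain N :: nat where N: "max K (max 1 (max (1 / cmod (minor m A u v r s)) (1 / ((cmod (y r))\<^sup>2 + (cmod (y s))\<^sup>2)))) \<le> N"
      using real_arch_simple by blast
    then have N1: "K \<le> N" "0 < N" by auto
    have "1 / cmod (minor m A u v r s) \<le> N" "1 / ((cmod (y r))\<^sup>2 + (cmod (y s))\<^sup>2) \<le> N" using N by auto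
    then have "1 / N \<le> cmod (minor m A u v r s)" "1 / N \<le> (cmod (y r))\<^sup>2 + (cmod (y s))\<^sup>2"
      using rs(3) Ypos N1 by (simp_all add: field_simps)
    then have "(A, u, v, \<mu>) \<in> independent_image_pairs n m p q r s N"
      using bA bu bv N1 ep unfolding independent_image_pairs_def y_def by (auto intro!: order_trans[OF bA] order_trans[OF bu] order_trans[OF bv])
    then have "A \<in> fst ` independent_image_pairs n m p q r s N" by (rule image_eqI[rotated]) simp
    then have "\<exists>N::nat. 0 < N \<and> A \<in> fst ` independent_image_pairs n m p q r s N"
      using N1(2) by (intro exI[of _ N]) simp
    then show ?thesis
      using rs(1,2) \<open>r \<noteq> s\<close> by (intro disjI1) (rule exI[of _ r], simp, rule exI[of _ s], simp)
  qed
qed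

section \<open>Gaussian estimates and moduli of continuity\<close>

lemma power_swap: "((a::real) ^ k) ^ numeral c = (a ^ numeral c) ^ k"
  by (metis power_mult mult.commute)

lemma normal_twelfth_moment:
  assumes "0 < \<sigma>"
  shows "integrable lborel (\<lambda>x. normal_density 0 \<sigma> x * x ^ 12)"
    and "(\<integral>x. normal_density 0 \<sigma> x * x ^ 12 \<partial>lborel) = 10395 * \<sigma> ^ 12"
proof -
  have *: "has_bochner_integral lborel (\<lambda>x. normal_density 0 \<sigma> x * (x - 0) ^ (2 * 6))
      (fact (2 * 6) / ((2 / \<sigma>\<^sup>2) ^ 6 * fact 6))"
    by (rule normal_moment_even[OF assms])
  have e: "fact (2 * 6) / ((2 / \<sigma>\<^sup>2) ^ 6 * fact 6) = 10395 * \<sigma> ^ 12"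
    using assms by (simp add: fact_numeral power_divide flip: power_mult)
  show "integrable lborel (\<lambda>x. normal_density 0 \<sigma> x * x ^ 12)"
    using * by (auto simp: has_bochner_integral_iff)
  show "(\<integral>x. normal_density 0 \<sigma> x * x ^ 12 \<partial>lborel) = 10395 * \<sigma> ^ 12"
    using * e by (simp add: has_bochner_integral_iff)
qed

text \<open>With step \<open>h\<close> and threshold \<open>h\<close> to the power \<open>2/5\<close>, the bound from the \<open>2p\<close>-th moment is \<open>h\<close> to the power \<open>p/5\<close>. It has to
beat the number \<open>1/h\<close> of steps, and \<open>2p = 12\<close> is the least even order that does.\<close>

lemma normal_tail_twelfth_power:
  assumes D: "distributed M lborel X (normal_density 0 \<sigma>)" and pos: "0 < \<sigma>" "0 < a"
  shows "measure M {\<omega>\<in>space M. a \<le> \<bar>X \<omega>\<bar>} \<le> 10395 * \<sigma> ^ 12 / a ^ 12"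
proof -
  have [measurable]: "X \<in> borel_measurable M" using distributed_measurable[OF D] by simp
  have i: "integrable M (\<lambda>\<omega>. X \<omega> ^ 12)"
    using distributed_integrable[OF D, of "\<lambda>x. x ^ 12"] normal_twelfth_moment(1)[OF pos(1)] by simp
  have e: "(\<integral>\<omega>. X \<omega> ^ 12 \<partial>M) = 10395 * \<sigma> ^ 12"
    using distributed_integral[OF D, of "\<lambda>x. x ^ 12"] normal_twelfth_moment(2)[OF pos(1)] by simp
  have "X \<omega> ^ 12 \<ge> a ^ 12 \<longleftrightarrow> a \<le> \<bar>X \<omega>\<bar>" for \<omega>
    using power_mono_iff[of a "\<bar>X \<omega>\<bar>" 12] pos(2) by simp
  then have "{\<omega>\<in>space M. a \<le> \<bar>X \<omega>\<bar>} = {\<omega>\<in>space M. X \<omega> ^ 12 \<ge> a ^ 12}" by simp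
  then show ?thesis
    using integral_Markov_inequality_measure[OF i, of "{}" "a ^ 12"] pos(2) e by simp
qed

lemma normal_small_ball:
  assumes D: "distributed M lborel X (normal_density 0 (sqrt t))" and pos: "0 < t" "0 \<le> \<rho>"
  shows "emeasure M {\<omega>\<in>space M. \<bar>X \<omega> - c\<bar> \<le> \<rho>} \<le> ennreal (\<rho> / sqrt t)"
proof -
  have "{\<omega>\<in>space M. \<bar>X \<omega> - c\<bar> \<le> \<rho>} = X -` {c - \<rho>..c + \<rho>} \<inter> space M" by auto
  then have "emeasure M {\<omega>\<in>space M. \<bar>X \<omega> - c\<bar> \<le> \<rho>} =
      (\<integral>\<^sup>+x. ennreal (normal_density 0 (sqrt t) x) * indicator {c - \<rho>..c + \<rho>} x \<partial>lborel)"
    using distributed_emeasure[OF D, of "{c - \<rho>..c + \<rho>}"] by simp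
  also have "\<dots> \<le> (\<integral>\<^sup>+x. ennreal (1 / (2 * sqrt t)) * indicator {c - \<rho>..c + \<rho>} x \<partial>lborel)"
  proof (intro nn_integral_mono mult_right_mono ennreal_leI)
    fix x
    have "2 * sqrt t = sqrt (4 * t)" by (simp add: real_sqrt_mult)
    also have "\<dots> \<le> sqrt (2 * pi * t)"
      using pos pi_gt3 by (intro real_sqrt_le_mono mult_right_mono) auto
    finally have "1 / sqrt (2 * pi * t) \<le> 1 / (2 * sqrt t)"
      using pos by (intro divide_left_mono) auto
    moreover have "exp (- (x\<^sup>2 / (2 * t))) \<le> 1" using pos by simp
    ultimately have "1 / sqrt (2 * pi * t) * exp (- (x\<^sup>2 / (2 * t))) \<le> 1 / (2 * sqrt t) * 1"
      using pos by (intro mult_mono) auto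
    then show "normal_density 0 (sqrt t) x \<le> 1 / (2 * sqrt t)"
      using pos by (simp add: normal_density_def)
  qed auto
  also have "\<dots> = ennreal (1 / (2 * sqrt t)) * ennreal (2 * \<rho>)"
    using pos by (simp add: nn_integral_cmult_indicator)
  also have "\<dots> = ennreal (\<rho> / sqrt t)"
    using pos by (simp flip: ennreal_mult)
  finally show ?thesis .
qed

text \<open>Hoelder continuity of order \<open>2/5\<close> along the grids of mesh \<open>32\<^sup>-\<^sup>k\<close>, since \<open>4 = 32\<close> to the power \<open>2/5\<close>.\<close>

definition holder_on_grid :: "(real \<Rightarrow> real) \<Rightarrow> bool" where
  "holder_on_grid f \<longleftrightarrow> (\<forall>T::nat. \<forall>\<^sub>F k in sequentially. \<forall>j < T * 32 ^ k.
      \<bar>f (real (Suc j) / 32 ^ k) - f (real j / 32 ^ k)\<bar> \<le> (1 / 4) ^ k)"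

text \<open>Markov's inequality bounds the probability of a large increment by a constant times \<open>64\<^sup>-\<^sup>k\<close>, and there are \<open>T 32\<^sup>k\<close>
increments, so the exceptional probabilities are summable.\<close>

lemma brownian_holder_on_grid:
  assumes "standard_brownian_motion M W"
  shows "AE \<omega> in M. holder_on_grid (\<lambda>t. W t \<omega>)"
proof -
  interpret prob_space M using assms by (simp add: standard_brownian_motion_def)
  have [measurable]: "W t \<in> borel_measurable M" if "0 \<le> t" for t
    using assms that by (simp add: standard_brownian_motion_def)
  have D: "distributed M lborel (\<lambda>\<omega>. W t \<omega> - W s \<omega>) (normal_density 0 (sqrt (t - s)))"
    if "0 \<le> s" "s < t" for s t
    using assms that by (simp add: standard_brownian_motion_def)
  have "AE \<omega> in M. \<forall>\<^sub>F k in sequentially. \<forall>j < T * 32 ^ k.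
      \<bar>W (real (Suc j) / 32 ^ k) \<omega> - W (real j / 32 ^ k) \<omega>\<bar> \<le> (1 / 4) ^ k" for T :: nat
  proof -
    define E where "E k j = {\<omega>\<in>space M. (1 / 4) ^ k \<le> \<bar>W (real (Suc j) / 32 ^ k) \<omega> - W (real j / 32 ^ k) \<omega>\<bar>}" for k j
    define A where "A k = (\<Union>j<T * 32 ^ k. E k j)" for k
    have [measurable]: "E k j \<in> sets M" for k j unfolding E_def by measurable
    have Am: "A k \<in> sets M" for k unfolding A_def by auto
    have pE: "prob (E k j) \<le> 10395 * (1 / 64) ^ k" for k j
    proof -
      have lt: "real j / 32 ^ k < real (Suc j) / 32 ^ k" by (simp add: divide_strict_right_mono)
      have df: "real (Suc j) / 32 ^ k - real j / 32 ^ k = (1 / 32) ^ k"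
        by (simp add: field_simps power_one_over)
      have "prob (E k j) \<le> 10395 * sqrt ((1 / 32) ^ k) ^ 12 / ((1 / 4) ^ k) ^ 12"
        unfolding E_def by (rule normal_tail_twelfth_power[OF D[OF _ lt, unfolded df]]) auto
      also have "sqrt ((1 / 32) ^ k) ^ 12 = ((1 / 32) ^ k) ^ 6"
      proof -
        have "sqrt ((1 / 32) ^ k) ^ 12 = (sqrt ((1 / 32) ^ k) ^ 2) ^ 6" by (simp only: power_mult[symmetric]) simp
        then show ?thesis by simp
      qed
      also have "10395 * ((1 / 32 :: real) ^ k) ^ 6 / ((1 / 4) ^ k) ^ 12 = 10395 * (1 / 64) ^ k"
      proof -
        have "((1 / 32 :: real) ^ k) ^ 6 = ((1 / 64) ^ k) * ((1 / 4) ^ k) ^ 12"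
          by (simp only: power_swap[of _ k] power_mult_distrib[symmetric]) (simp add: power_divide)
        then show ?thesis by simp
      qed
      finally show ?thesis .
    qed
    have pA: "prob (A k) \<le> 10395 * T * (1 / 2) ^ k" for k
    proof -
      have "prob (A k) \<le> (\<Sum>j<T * 32 ^ k. prob (E k j))"
        unfolding A_def by (intro finite_measure_subadditive_finite) auto
      also have "\<dots> \<le> card {..<T * 32 ^ k} * (10395 * (1 / 64) ^ k)"
        by (intro sum_bounded_above pE)
      also have "\<dots> = 10395 * T * (32 ^ k * (1 / 64) ^ k)" by simp
      also have "\<dots> = 10395 * T * (1 / 2) ^ k" by (simp flip: power_mult_distrib)
      finally show ?thesis .
    qed
    have "summable (\<lambda>k. prob (A k))"
    proof (rule summable_comparison_test')
      show "summable (\<lambda>k. 10395 * real T * (1 / 2) ^ k)" by (intro summable_mult summable_geometric) auto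
      show "norm (prob (A k)) \<le> 10395 * real T * (1 / 2) ^ k" for k using pA[of k] by simp
    qed
    then have "AE \<omega> in M. \<forall>\<^sub>F k in sequentially. \<omega> \<in> space M - A k"
      by (intro borel_cantelli_AE1 Am) (auto simp: emeasure_eq_measure)
    then show ?thesis
    proof eventually_elim
      case (elim \<omega>)
      then show ?case by eventually_elim (auto simp: A_def E_def not_le intro: less_imp_le)
    qed
  qed
  then show ?thesis unfolding holder_on_grid_def by (subst AE_all_countable) auto
qed

text \<open>Chaining: the grid points below \<open>t\<close> at two consecutive levels are at most \<open>31\<close> steps of the finer
level apart.\<close>

lemma refine_grid_step:
  fixes f :: "real \<Rightarrow> real"
  assumes inc: "\<And>j. j < T * 32 ^ Suc k \<Longrightarrow>
      \<bar>f (real (Suc j) / 32 ^ Suc k) - f (real j / 32 ^ Suc k)\<bar> \<le> (1 / 4) ^ Suc k"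
    and t: "0 \<le> t" "t < real T"
  shows "\<bar>f (real (nat \<lfloor>t * 32 ^ Suc k\<rfloor>) / 32 ^ Suc k) - f (real (nat \<lfloor>t * 32 ^ k\<rfloor>) / 32 ^ k)\<bar> \<le> 8 * (1 / 4) ^ k"
proof -
  define a where "a = nat \<lfloor>t * 32 ^ k\<rfloor>"
  define b where "b = nat \<lfloor>t * 32 ^ Suc k\<rfloor>"
  have a: "real a \<le> t * 32 ^ k" "t * 32 ^ k < real a + 1"
    using t unfolding a_def by (auto simp: of_nat_nat)
  have b: "real b \<le> t * 32 ^ Suc k" "t * 32 ^ Suc k < real b + 1"
    using t unfolding b_def by (auto simp: of_nat_nat)
  have "32 * real a < real b + 1" "real b < 32 * real a + 32" using a b by auto
  then have ab: "32 * a \<le> b" "b < 32 * a + 32" by linarith+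
  have bT: "b \<le> T * 32 ^ Suc k"
  proof -
    have "t * 32 ^ Suc k \<le> real T * 32 ^ Suc k" using t by (intro mult_right_mono) auto
    with b(1) have "real b \<le> real T * 32 ^ Suc k" by (rule order_trans)
    then have "real b \<le> real (T * 32 ^ Suc k)" by simp
    then show ?thesis by (simp only: of_nat_le_iff)
  qed
  have "\<bar>f (real (32 * a + i) / 32 ^ Suc k) - f (real (32 * a) / 32 ^ Suc k)\<bar> \<le> real i * (1 / 4) ^ Suc k"
    if "32 * a + i \<le> b" for i
    using that
  proof (induction i)
    case (Suc i)
    have "\<bar>f (real (Suc (32 * a + i)) / 32 ^ Suc k) - f (real (32 * a + i) / 32 ^ Suc k)\<bar> \<le> (1 / 4) ^ Suc k"
      using Suc.prems bT by (intro inc) linarith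
    moreover have "real (Suc i) * (1 / 4 :: real) ^ Suc k = real i * (1 / 4) ^ Suc k + (1 / 4) ^ Suc k"
      by (simp add: distrib_right)
    moreover have "32 * a + Suc i = Suc (32 * a + i)" by simp
    ultimately show ?case using Suc.IH Suc.prems by (smt (verit) Suc_leD add_Suc_right)
  qed simp
  from this[of "b - 32 * a"] ab
  have "\<bar>f (real b / 32 ^ Suc k) - f (real (32 * a) / 32 ^ Suc k)\<bar> \<le> real (b - 32 * a) * (1 / 4) ^ Suc k"
    by simp
  also have "\<dots> \<le> 32 * (1 / 4) ^ Suc k"
    using ab by (intro mult_right_mono) auto
  finally show ?thesis unfolding a_def[symmetric] b_def[symmetric] by simp
qed

text \<open>Summing the chain over all finer levels and letting the level tend to infinity transfers the bound from
the grid to every time. The constant \<open>11\<close> exceeds \<open>8\<close> times the geometric series with ratio \<open>1/4\<close>.\<close>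

lemma holder_on_grid_interval:
  fixes f :: "real \<Rightarrow> real"
  assumes f: "holder_on_grid f" "continuous_on {0..} f"
  shows "\<forall>\<^sub>F k in sequentially. \<forall>t. 0 \<le> t \<longrightarrow> t < real T \<longrightarrow>
           \<bar>f t - f (real (nat \<lfloor>t * 32 ^ k\<rfloor>) / 32 ^ k)\<bar> \<le> 11 * (1 / 4) ^ k"
proof -
  obtain k0 where k0: "\<And>k j. k0 \<le> k \<Longrightarrow> j < T * 32 ^ k \<Longrightarrow>
      \<bar>f (real (Suc j) / 32 ^ k) - f (real j / 32 ^ k)\<bar> \<le> (1 / 4) ^ k"
    using f(1) unfolding holder_on_grid_def eventually_sequentially by blast
  have "\<bar>f t - f (real (nat \<lfloor>t * 32 ^ k\<rfloor>) / 32 ^ k)\<bar> \<le> 11 * (1 / 4) ^ k"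
    if k: "k0 \<le> k" and t: "0 \<le> t" "t < real T" for k t
  proof -
    define a where "a i = real (nat \<lfloor>t * 32 ^ i\<rfloor>) / 32 ^ i" for i :: nat
    have step: "\<bar>f (a (k + l)) - f (a k)\<bar> \<le> 11 * ((1 / 4) ^ k - (1 / 4) ^ (k + l))" for l
    proof (induction l)
      case (Suc l)
      have "\<bar>f (a (Suc (k + l))) - f (a (k + l))\<bar> \<le> 8 * (1 / 4) ^ (k + l)"
        unfolding a_def by (intro refine_grid_step[where T = T] k0 t) (use k in auto)
      moreover have "8 * (1 / 4 :: real) ^ (k + l) \<le> 11 * (1 / 4) ^ (k + l) - 11 * (1 / 4) ^ (k + Suc l)"
        by simp
      ultimately show ?case using Suc.IH by simp
    qed simp
    have a_lim: "a \<longlonglongrightarrow> t"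
    proof (rule tendsto_sandwich)
      have bnd: "t - (1 / 32) ^ i \<le> a i \<and> a i \<le> t" for i
      proof -
        have fl: "real (nat \<lfloor>t * 32 ^ i\<rfloor>) = of_int \<lfloor>t * 32 ^ i\<rfloor>" using t by simp
        have "t * 32 ^ i - 1 \<le> of_int \<lfloor>t * 32 ^ i\<rfloor>" and "of_int \<lfloor>t * 32 ^ i\<rfloor> \<le> t * 32 ^ i"
          by linarith+
        from this[THEN divide_right_mono, of "32 ^ i"] show ?thesis
          unfolding a_def fl by (simp add: diff_divide_distrib power_one_over)
      qed
      show "\<forall>\<^sub>F i in sequentially. t - (1 / 32) ^ i \<le> a i" "\<forall>\<^sub>F i in sequentially. a i \<le> t"
        using bnd by auto
      show "(\<lambda>i. t - (1 / 32) ^ i) \<longlonglongrightarrow> t"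
        by (rule tendsto_eq_intros | (rule LIMSEQ_power_zero; simp) | simp)+
    qed simp
    have "(\<lambda>i. f (a i)) \<longlonglongrightarrow> f t"
      by (rule continuous_on_tendsto_compose[OF f(2) a_lim]) (use t in \<open>auto simp: a_def\<close>)
    then have "(\<lambda>l. f (a (l + k))) \<longlonglongrightarrow> f t" by (rule LIMSEQ_ignore_initial_segment)
    then have "(\<lambda>l. \<bar>f (a (l + k)) - f (a k)\<bar>) \<longlonglongrightarrow> \<bar>f t - f (a k)\<bar>" by (intro tendsto_intros)
    moreover have "\<bar>f (a (l + k)) - f (a k)\<bar> \<le> 11 * (1 / 4) ^ k" for l
    proof -
      have "11 * ((1 / 4) ^ k - (1 / 4) ^ (k + l)) \<le> 11 * (1 / 4 :: real) ^ k" by simp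
      with step[of l] show ?thesis by (simp only: add.commute)
    qed
    ultimately have "\<bar>f t - f (a k)\<bar> \<le> 11 * (1 / 4) ^ k" by (intro LIMSEQ_le_const2) auto
    then show ?thesis by (simp add: a_def)
  qed
  then show ?thesis unfolding eventually_sequentially by blast
qed

section \<open>Brownian matrices avoid thin sets\<close>

lemma initial_matrix_measurable:
  assumes "complex_brownian_matrix M n m B"
  shows "(\<lambda>\<omega>. \<lambda>k\<in>coord_index n m. real_coord (B 0 \<omega>) k)
           \<in> measurable M (PiM (coord_index n m) (\<lambda>_. borel))"
proof -
  define X where "X \<omega> = (\<lambda>k\<in>coord_index n m. real_coord (B 0 \<omega>) k)" for \<omega>
  define S where "S = (PiM (coord_index n m) (\<lambda>_. borel) :: (bool \<times> nat \<times> nat \<Rightarrow> real) measure)"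
  interpret prob_space M using assms by (simp add: complex_brownian_matrix_def)
  have "sets (vimage_algebra (space M) X S) \<subseteq> events"
    using assms unfolding complex_brownian_matrix_def Let_def X_def S_def
    by (blast dest: indep_setD_ev1)
  moreover have Xs: "X \<in> space M \<rightarrow> space S" by (auto simp: X_def S_def space_PiM)
  moreover have "sets (vimage_algebra (space M) X S) = {X -` A \<inter> space M | A. A \<in> sets S}"
    by (rule sets_vimage_algebra2[OF Xs])
  ultimately have "X \<in> measurable M S" by (intro measurableI) auto
  then show ?thesis unfolding X_def S_def .
qed

lemma real_coord_measurable:
  assumes BM: "complex_brownian_matrix M n m B" and k: "k \<in> coord_index n m" and s: "0 \<le> s"
  shows "(\<lambda>\<omega>. real_coord (B s \<omega>) k) \<in> borel_measurable M"
proof -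
  have "(\<lambda>\<omega>. real_coord (B 0 \<omega>) k) \<in> borel_measurable M"
    using measurable_compose[OF initial_matrix_measurable[OF BM] measurable_component_singleton[OF k]] k
    by simp
  moreover have "standard_brownian_motion M (\<lambda>s \<omega>. real_coord (B s \<omega>) k - real_coord (B 0 \<omega>) k)"
    using BM k unfolding complex_brownian_matrix_def Let_def by blast
  then have "(\<lambda>\<omega>. real_coord (B s \<omega>) k - real_coord (B 0 \<omega>) k) \<in> borel_measurable M"
    using s unfolding standard_brownian_motion_def by blast
  ultimately have "(\<lambda>\<omega>. real_coord (B 0 \<omega>) k + (real_coord (B s \<omega>) k - real_coord (B 0 \<omega>) k))
      \<in> borel_measurable M"
    by (rule borel_measurable_add)
  then show ?thesis by simp
qed

text \<open>Conditionally on the initial matrix, the matrix at time \<open>t\<close> has \<open>2nm\<close> independent Gaussian coordinates, each with density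
at most \<open>1 / (2 sqrt t)\<close>. Hence the bound holds uniformly in the centre of the cube and in the law of the initial matrix.\<close>

lemma brownian_matrix_small_ball:
  fixes M :: "'a measure"
  assumes BM: "complex_brownian_matrix M n m B" and nm: "0 < n" "0 < m"
    and t: "0 < t" and \<rho>: "0 \<le> \<rho>"
  shows "emeasure M {\<omega>\<in>space M. \<forall>k\<in>coord_index n m. \<bar>real_coord (B t \<omega>) k - g k\<bar> \<le> \<rho>}
           \<le> ennreal ((\<rho> / sqrt t) ^ (2 * n * m))"
proof -
  define K where "K = coord_index n m"
  define W where "W k t \<omega> = real_coord (B t \<omega>) k - real_coord (B 0 \<omega>) k" for k t \<omega>
  define X where "X \<omega> = (\<lambda>k\<in>K. real_coord (B 0 \<omega>) k)" for \<omega>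
  define Y where "Y \<omega> = (\<lambda>k\<in>K. \<lambda>t\<in>{0..}. W k t \<omega>)" for \<omega>
  define S where "S = (PiM K (\<lambda>_. borel) :: (bool \<times> nat \<times> nat \<Rightarrow> real) measure)"
  define P where "P = (PiM {0..} (\<lambda>_. borel) :: (real \<Rightarrow> real) measure)"
  define T where "T = PiM K (\<lambda>_. P)"
  interpret prob_space M using BM by (simp add: complex_brownian_matrix_def)
  have SB: "standard_brownian_motion M (W k)" if "k \<in> K" for k
    using BM that unfolding complex_brownian_matrix_def Let_def K_def W_def by blast
  have ind: "indep_vars (\<lambda>_. P) (\<lambda>k \<omega>. \<lambda>t\<in>{0..}. W k t \<omega>) K"
    using BM unfolding complex_brownian_matrix_def Let_def K_def W_def P_def by blast
  have ind0: "indep_set (sets (vimage_algebra (space M) X S)) (sets (vimage_algebra (space M) Y T))"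
    using BM unfolding complex_brownian_matrix_def Let_def K_def W_def X_def Y_def S_def T_def P_def by blast
  have finK: "finite K" and cardK: "card K = 2 * n * m" and K0: "K \<noteq> {}"
    using nm by (auto simp: K_def coord_index_def card_cartesian_product)
  have Xs: "X \<in> space M \<rightarrow> space S" by (auto simp: X_def S_def space_PiM)
  have Ys: "Y \<in> space M \<rightarrow> space T" by (auto simp: Y_def T_def P_def space_PiM)
  \<comment> \<open>passing from the paths to their values at time \<open>t\<close> gives \<open>V\<close> the same type as the initial matrix \<open>X\<close>\<close>
  define V where "V \<omega> = (\<lambda>k\<in>K. W k t \<omega>)" for \<omega>
  define ev where "ev f = (\<lambda>k\<in>K. f k t)" for f :: "bool \<times> nat \<times> nat \<Rightarrow> real \<Rightarrow> real"
  have "(\<lambda>f. f k t) \<in> borel_measurable T" if "k \<in> K" for k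
  proof -
    have "(\<lambda>f. f k) \<in> measurable T P" unfolding T_def using that by measurable
    moreover have "(\<lambda>f. f t) \<in> measurable P borel"
      unfolding P_def using t by (intro measurable_component_singleton) auto
    ultimately show ?thesis by (rule measurable_compose)
  qed
  then have ev: "ev \<in> measurable T S"
    unfolding S_def ev_def by (intro measurable_restrict)
  have V: "V \<omega> = ev (Y \<omega>)" for \<omega> using t by (auto simp: V_def ev_def Y_def)
  have iv: "indep_var S X S V"
    unfolding indep_var_eq
  proof (intro conjI indep_set_sigma_sets)
    have x: "sets (vimage_algebra (space M) X S) = {X -` A \<inter> space M | A. A \<in> sets S}"
      by (rule sets_vimage_algebra2[OF Xs])
    have y: "sets (vimage_algebra (space M) Y T) = {Y -` A \<inter> space M | A. A \<in> sets T}"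
      by (rule sets_vimage_algebra2[OF Ys])
    have sub: "{V -` A \<inter> space M |A. A \<in> sets S} \<subseteq> {Y -` A \<inter> space M | A. A \<in> sets T}"
    proof clarify
      fix A assume "A \<in> sets S"
      then have "ev -` A \<inter> space T \<in> sets T" by (rule measurable_sets[OF ev])
      moreover have "V -` A \<inter> space M = Y -` (ev -` A \<inter> space T) \<inter> space M"
        using Ys by (auto simp: V)
      ultimately show "\<exists>A'. V -` A \<inter> space M = Y -` A' \<inter> space M \<and> A' \<in> sets T" by blast
    qed
    show "random_variable S X"
      using initial_matrix_measurable[OF BM] unfolding X_def[abs_def] S_def K_def .
    have "random_variable T Y"
      using Ys indep_setD_ev2[OF ind0] unfolding y by (intro measurableI) auto
    from measurable_compose[OF this ev] show "random_variable S V" by (simp only: V[abs_def])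
    show "indep_set {X -` A \<inter> space M |A. A \<in> sets S} {V -` A \<inter> space M |A. A \<in> sets S}"
    proof (rule indep_setI)
      show "{X -` A \<inter> space M |A. A \<in> sets S} \<subseteq> events"
        using indep_setD_ev1[OF ind0] unfolding x .
      show "{V -` A \<inter> space M |A. A \<in> sets S} \<subseteq> events"
        using sub indep_setD_ev2[OF ind0] unfolding y by (rule order_trans)
      show "prob (a \<inter> b) = prob a * prob b"
        if "a \<in> {X -` A \<inter> space M |A. A \<in> sets S}" "b \<in> {V -` A \<inter> space M |A. A \<in> sets S}" for a b
        using indep_setD[OF ind0, of a b] that sub unfolding x y by blast
    qed
    have "Int_stable {F -` A \<inter> space M |A. A \<in> sets S}" for F :: "'a \<Rightarrow> bool \<times> nat \<times> nat \<Rightarrow> real"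
    proof -
      have "Int_stable ((\<lambda>A. F -` A \<inter> space M) ` sets S)"
      proof (rule Int_stableI_image)
        fix A A' assume "A \<in> sets S" "A' \<in> sets S"
        then have "A \<inter> A' \<in> sets S" by (rule sets.Int)
        moreover have "(F -` A \<inter> space M) \<inter> (F -` A' \<inter> space M) = F -` (A \<inter> A') \<inter> space M" by auto
        ultimately show "\<exists>C\<in>sets S. (F -` A \<inter> space M) \<inter> (F -` A' \<inter> space M) = F -` C \<inter> space M"
          by (rule bexI[rotated])
      qed
      then show ?thesis by (simp only: setcompr_eq_image Collect_mem_eq)
    qed
    then show "Int_stable {X -` A \<inter> space M |A. A \<in> sets S}"
      and "Int_stable {V -` A \<inter> space M |A. A \<in> sets S}" by blast+
  qed
  have [measurable]: "X \<in> measurable M S" "V \<in> measurable M S"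
    using iv by (auto dest: indep_var_rv1 indep_var_rv2)
  have W0: "W k 0 \<omega> = 0" for k \<omega> by (simp add: W_def)
  have ball: "emeasure M {\<omega>\<in>space M. \<forall>k\<in>K. \<bar>W k t \<omega> - c k\<bar> \<le> \<rho>} \<le> ennreal ((\<rho> / sqrt t) ^ (2 * n * m))" for c
  proof -
    have ind1: "indep_vars (\<lambda>_. borel) (\<lambda>k \<omega>. W k t \<omega>) K"
    proof -
      have "indep_vars (\<lambda>_. borel) (\<lambda>k \<omega>. (\<lambda>f. f t) (\<lambda>t\<in>{0..}. W k t \<omega>)) K"
        using t by (intro indep_vars_compose2[OF ind]) (auto simp: P_def intro!: measurable_component_singleton)
      then show ?thesis using t by simp
    qed
    have "{\<omega>\<in>space M. \<forall>k\<in>K. \<bar>W k t \<omega> - c k\<bar> \<le> \<rho>} = (\<Inter>k\<in>K. W k t -` {c k - \<rho>..c k + \<rho>} \<inter> space M)"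
      using K0 by (auto simp: abs_le_iff)
    then have "prob {\<omega>\<in>space M. \<forall>k\<in>K. \<bar>W k t \<omega> - c k\<bar> \<le> \<rho>} =
        (\<Prod>k\<in>K. prob (W k t -` {c k - \<rho>..c k + \<rho>} \<inter> space M))"
      using indep_varsD_finite[OF ind1 K0 finK, of "\<lambda>k. {c k - \<rho>..c k + \<rho>}"] by simp
    also have "\<dots> \<le> (\<Prod>k\<in>K. \<rho> / sqrt t)"
    proof (intro prod_mono conjI)
      fix k assume k: "k \<in> K"
      have "distributed M lborel (\<lambda>\<omega>. W k t \<omega> - W k 0 \<omega>) (normal_density 0 (sqrt (t - 0)))"
        using SB[OF k] t unfolding standard_brownian_motion_def by blast
      then have "distributed M lborel (W k t) (normal_density 0 (sqrt t))" by (simp add: W0)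
      from normal_small_ball[OF this t \<rho>, of "c k"]
      have "prob {\<omega>\<in>space M. \<bar>W k t \<omega> - c k\<bar> \<le> \<rho>} \<le> \<rho> / sqrt t"
        using \<rho> t by (simp add: emeasure_eq_measure)
      moreover have "W k t -` {c k - \<rho>..c k + \<rho>} \<inter> space M = {\<omega>\<in>space M. \<bar>W k t \<omega> - c k\<bar> \<le> \<rho>}"
        by (auto simp: abs_le_iff)
      ultimately show "prob (W k t -` {c k - \<rho>..c k + \<rho>} \<inter> space M) \<le> \<rho> / sqrt t" by simp
    qed simp
    also have "\<dots> = (\<rho> / sqrt t) ^ (2 * n * m)" by (simp add: cardK)
    finally show ?thesis by (simp add: emeasure_eq_measure ennreal_leI)
  qed
  have ev1[measurable]: "(\<lambda>f. f k) \<in> borel_measurable S" if "k \<in> K" for k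
    unfolding S_def using that by measurable
  have Vs: "V \<in> space M \<rightarrow> space S" by (auto simp: V_def S_def space_PiM)
  \<comment> \<open>Fubini: the cube seen from a fixed initial matrix is again a cube\<close>
  define A where "A = {z \<in> space (S \<Otimes>\<^sub>M S). \<forall>k\<in>K. \<bar>fst z k + snd z k - g k\<bar> \<le> \<rho>}"
  have [measurable]: "A \<in> sets (S \<Otimes>\<^sub>M S)"
  proof -
    have "(\<lambda>z. fst z k + snd z k - g k) \<in> borel_measurable (S \<Otimes>\<^sub>M S)" if "k \<in> K" for k
      using measurable_compose[OF measurable_fst ev1[OF that]] measurable_compose[OF measurable_snd ev1[OF that]]
      by measurable
    then show ?thesis unfolding A_def using finK by measurable
  qed
  interpret D: prob_space "distr M S V" by (rule prob_space_distr) simp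
  interpret D1: prob_space "distr M S X" by (rule prob_space_distr) simp
  have "{\<omega>\<in>space M. \<forall>k\<in>K. \<bar>real_coord (B t \<omega>) k - g k\<bar> \<le> \<rho>} = (\<lambda>\<omega>. (X \<omega>, V \<omega>)) -` A \<inter> space M"
    using t Xs Vs by (auto simp: A_def X_def[abs_def] V_def[abs_def] W_def space_pair_measure)
  then have "emeasure M {\<omega>\<in>space M. \<forall>k\<in>K. \<bar>real_coord (B t \<omega>) k - g k\<bar> \<le> \<rho>} =
      emeasure (distr M (S \<Otimes>\<^sub>M S) (\<lambda>\<omega>. (X \<omega>, V \<omega>))) A"
    by (simp add: emeasure_distr)
  also have "\<dots> = emeasure (distr M S X \<Otimes>\<^sub>M distr M S V) A"
    using iv unfolding indep_var_distribution_eq by simp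
  also have "\<dots> = (\<integral>\<^sup>+x. emeasure (distr M S V) (Pair x -` A) \<partial>distr M S X)"
    by (rule D.emeasure_pair_measure_alt) simp
  also have "\<dots> \<le> (\<integral>\<^sup>+x. ennreal ((\<rho> / sqrt t) ^ (2 * n * m)) \<partial>distr M S X)"
  proof (rule nn_integral_mono)
    fix x assume "x \<in> space (distr M S X)"
    then have x: "x \<in> space S" by simp
    have "emeasure (distr M S V) (Pair x -` A) = emeasure M (V -` (Pair x -` A) \<inter> space M)"
      by (rule emeasure_distr) (auto intro: sets_Pair1)
    also have "V -` (Pair x -` A) \<inter> space M = {\<omega>\<in>space M. \<forall>k\<in>K. \<bar>W k t \<omega> - (g k - x k)\<bar> \<le> \<rho>}"
      using t x Vs by (auto simp: A_def V_def[abs_def] space_pair_measure algebra_simps)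
    also have "emeasure M \<dots> \<le> ennreal ((\<rho> / sqrt t) ^ (2 * n * m))" by (rule ball)
    finally show "emeasure (distr M S V) (Pair x -` A) \<le> ennreal ((\<rho> / sqrt t) ^ (2 * n * m))" .
  qed
  also have "\<dots> = ennreal ((\<rho> / sqrt t) ^ (2 * n * m))" using D1.emeasure_space_1 by simp
  finally show "emeasure M {\<omega>\<in>space M. \<forall>k\<in>coord_index n m. \<bar>real_coord (B t \<omega>) k - g k\<bar> \<le> \<rho>}
           \<le> ennreal ((\<rho> / sqrt t) ^ (2 * n * m))" by (simp add: K_def)
qed

text \<open>A path that meets \<open>S\<close> at a time \<open>t\<close> is, at the preceding grid time, within \<open>(C + 11) 4\<^sup>-\<^sup>k\<close> of a centre. The lower
bound \<open>\<delta>\<close> on time keeps the Gaussian densities bounded; grid times of at least \<open>\<delta> / 2\<close> suffice for all large \<open>k\<close>.\<close>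

lemma brownian_matrix_avoids_thin:
  fixes M :: "'a measure" and T :: nat
  assumes BM: "complex_brownian_matrix M n m B" and nm: "0 < n" "0 < m"
    and S: "thin n m S" and \<delta>: "0 < \<delta>"
  shows "AE \<omega> in M. \<forall>t. \<delta> \<le> t \<longrightarrow> t < real T \<longrightarrow> (\<lambda>i j. B t \<omega> $$ (i, j)) \<notin> S"
proof -
  interpret prob_space M using BM by (simp add: complex_brownian_matrix_def)
  define K where "K = coord_index n m"
  have finK: "finite K" by (simp add: K_def coord_index_def)
  define W where "W k t \<omega> = real_coord (B t \<omega>) k - real_coord (B 0 \<omega>) k" for k t \<omega>
  have SB: "standard_brownian_motion M (W k)" if "k \<in> K" for k
    using BM that unfolding complex_brownian_matrix_def Let_def K_def W_def by blast
  obtain C where C: "1 \<le> C" and cov: "\<And>\<epsilon>. 0 < \<epsilon> \<Longrightarrow> \<epsilon> \<le> 1 \<Longrightarrow>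
      \<exists>F. finite F \<and> real (card F) * \<epsilon> ^ (2 * n * m) \<le> C * \<epsilon> ^ 3 \<and>
             (\<forall>A\<in>S. \<exists>G\<in>F. \<forall>i<n. \<forall>j<m. cmod (A i j - G i j) \<le> C * \<epsilon>)"
    using S unfolding thin_def by blast
  have "\<forall>k::nat. \<exists>F. finite F \<and> real (card F) * ((1 / 4) ^ k) ^ (2 * n * m) \<le> C * ((1 / 4) ^ k) ^ 3 \<and>
             (\<forall>A\<in>S. \<exists>G\<in>F. \<forall>i<n. \<forall>j<m. cmod (A i j - G i j) \<le> C * (1 / 4) ^ k)"
    by (intro allI cov) (auto simp: power_le_one)
  then obtain F where F: "\<And>k. finite (F k)"
      "\<And>k. real (card (F k)) * ((1 / 4) ^ k) ^ (2 * n * m) \<le> C * ((1 / 4) ^ k) ^ 3"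
      "\<And>k A. A \<in> S \<Longrightarrow> \<exists>G\<in>F k. \<forall>i<n. \<forall>j<m. cmod (A i j - G i j) \<le> C * (1 / 4) ^ k"
    by metis
  define co where "co G e = (case e of (b, i, j) \<Rightarrow> if b then Im (G i j) else Re (G i j))"
    for G :: "nat \<Rightarrow> nat \<Rightarrow> complex" and e :: "bool \<times> nat \<times> nat"
  define \<rho> where "\<rho> k = (C + 11) * (1 / 4) ^ k" for k :: nat
  \<comment> \<open>the path is near the centre \<open>G\<close> at the grid time \<open>j / 32\<^sup>k\<close>; \<open>A k\<close> is the union over all grid times and centres\<close>
  define E where "E k j G = {\<omega>\<in>space M. \<forall>e\<in>coord_index n m.
      \<bar>real_coord (B (real j / 32 ^ k) \<omega>) e - co G e\<bar> \<le> \<rho> k}" for k j :: nat and G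
  define J where "J k = {j. j < T * 32 ^ k \<and> \<delta> / 2 \<le> real j / 32 ^ k}" for k :: nat
  define A where "A k = (\<Union>(j, G)\<in>J k \<times> F k. E k j G)" for k
  define c where "c = ((C + 11) / sqrt (\<delta> / 2)) ^ (2 * n * m)"
  have c0: "0 \<le> c" unfolding c_def using C \<delta> by (intro zero_le_power divide_nonneg_nonneg) auto
  have Jsub: "J k \<subseteq> {..<T * 32 ^ k}" for k by (auto simp: J_def)
  then have finJ: "finite (J k)" for k by (rule finite_subset) simp
  have cardJ: "real (card (J k)) \<le> real T * 32 ^ k" for k
  proof -
    have "card (J k) \<le> T * 32 ^ k" using card_mono[OF _ Jsub[of k]] by simp
    then have "real (card (J k)) \<le> real (T * 32 ^ k)" by (simp only: of_nat_le_iff)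
    then show ?thesis by simp
  qed
  have Em: "E k j G \<in> sets M" for k j G
  proof -
    have "(\<lambda>\<omega>. real_coord (B (real j / 32 ^ k) \<omega>) e) \<in> borel_measurable M" if "e \<in> coord_index n m" for e
      by (rule real_coord_measurable[OF BM that]) simp
    then show ?thesis unfolding E_def using finK unfolding K_def by measurable
  qed
  have Am: "A k \<in> sets M" for k unfolding A_def using finJ F(1) Em by auto
  have pE: "prob (E k j G) \<le> c * ((1 / 4) ^ k) ^ (2 * n * m)" if "j \<in> J k" for k j G
  proof -
    have j: "\<delta> / 2 \<le> real j / 32 ^ k" using that by (simp add: J_def)
    have jpos: "0 < real j / 32 ^ k" using j \<delta> by linarith
    have r0: "0 \<le> \<rho> k" using C by (simp add: \<rho>_def)
    have "emeasure M (E k j G) \<le> ennreal ((\<rho> k / sqrt (real j / 32 ^ k)) ^ (2 * n * m))"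
      unfolding E_def by (rule brownian_matrix_small_ball[OF BM nm jpos r0])
    then have "prob (E k j G) \<le> (\<rho> k / sqrt (real j / 32 ^ k)) ^ (2 * n * m)"
      using r0 by (simp add: emeasure_eq_measure)
    also have "\<dots> \<le> (\<rho> k / sqrt (\<delta> / 2)) ^ (2 * n * m)"
      using r0 j jpos \<delta> by (intro power_mono divide_left_mono real_sqrt_le_mono) auto
    also have "\<rho> k / sqrt (\<delta> / 2) = (C + 11) / sqrt (\<delta> / 2) * (1 / 4) ^ k" by (simp add: \<rho>_def)
    finally show ?thesis by (simp only: c_def power_mult_distrib)
  qed
  have pA: "prob (A k) \<le> real T * c * C * (1 / 2) ^ k" for k
  proof -
    have "prob (A k) \<le> (\<Sum>z\<in>J k \<times> F k. prob (case z of (j, G) \<Rightarrow> E k j G))"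
      unfolding A_def using finJ F(1) Em by (intro finite_measure_subadditive_finite) auto
    also have "\<dots> \<le> real (card (J k \<times> F k)) * (c * ((1 / 4) ^ k) ^ (2 * n * m))"
      using pE by (intro sum_bounded_above) auto
    also have "\<dots> = real (card (J k)) * (c * (real (card (F k)) * ((1 / 4) ^ k) ^ (2 * n * m)))"
      by (simp add: card_cartesian_product)
    also have "\<dots> \<le> (real T * 32 ^ k) * (c * (C * ((1 / 4) ^ k) ^ 3))"
      using c0 by (intro mult_mono[OF cardJ mult_left_mono[OF F(2) c0]] mult_nonneg_nonneg) auto
    also have "\<dots> = real T * c * C * (32 ^ k * ((1 / 4) ^ k) ^ 3)" by simp
    also have "32 ^ k * ((1 / 4 :: real) ^ k) ^ 3 = (1 / 2) ^ k"
      by (simp only: power_swap[of _ k] power_mult_distrib[symmetric]) (simp add: power_divide)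
    finally show ?thesis .
  qed
  have "summable (\<lambda>k. prob (A k))"
  proof (rule summable_comparison_test')
    show "summable (\<lambda>k. real T * c * C * (1 / 2) ^ k)" by (intro summable_mult summable_geometric) auto
    show "norm (prob (A k)) \<le> real T * c * C * (1 / 2) ^ k" for k using pA[of k] by simp
  qed
  then have ae1: "AE \<omega> in M. \<forall>\<^sub>F k in sequentially. \<omega> \<in> space M - A k"
    by (intro borel_cantelli_AE1 Am) (auto simp: emeasure_eq_measure)
  have ae2: "AE \<omega> in M. \<forall>e\<in>K. holder_on_grid (\<lambda>t. W e t \<omega>)"
    using SB by (intro AE_finite_allI[OF finK] brownian_holder_on_grid)
  have ae3: "AE \<omega> in M. \<forall>e\<in>K. continuous_on {0..} (\<lambda>t. W e t \<omega>)"
    using SB by (intro AE_finite_allI[OF finK]) (simp add: standard_brownian_motion_def)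
  from ae1 ae2 ae3 show ?thesis
  proof eventually_elim
    case (elim \<omega>)
    have ev2: "\<forall>\<^sub>F k in sequentially. \<forall>e\<in>K. \<forall>t. 0 \<le> t \<longrightarrow> t < real T \<longrightarrow>
           \<bar>W e t \<omega> - W e (real (nat \<lfloor>t * 32 ^ k\<rfloor>) / 32 ^ k) \<omega>\<bar> \<le> 11 * (1 / 4) ^ k"
      using elim(2,3) by (intro eventually_ball_finite finK ballI holder_on_grid_interval) auto
    have "(\<lambda>k. (1 / 32 :: real) ^ k) \<longlonglongrightarrow> 0" by (rule LIMSEQ_power_zero) simp
    then have "\<forall>\<^sub>F k in sequentially. (1 / 32 :: real) ^ k < \<delta> / 2"
      by (rule order_tendstoD) (use \<delta> in simp)
    with elim(1) ev2 have "\<forall>\<^sub>F k in sequentially. \<omega> \<in> space M - A k \<and> (1 / 32 :: real) ^ k < \<delta> / 2 \<and>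
        (\<forall>e\<in>K. \<forall>t. 0 \<le> t \<longrightarrow> t < real T \<longrightarrow>
           \<bar>W e t \<omega> - W e (real (nat \<lfloor>t * 32 ^ k\<rfloor>) / 32 ^ k) \<omega>\<bar> \<le> 11 * (1 / 4) ^ k)"
      by eventually_elim simp
    then obtain k where k: "\<omega> \<in> space M" "\<omega> \<notin> A k" "(1 / 32 :: real) ^ k < \<delta> / 2"
      "\<And>e t. e \<in> K \<Longrightarrow> 0 \<le> t \<Longrightarrow> t < real T \<Longrightarrow>
           \<bar>W e t \<omega> - W e (real (nat \<lfloor>t * 32 ^ k\<rfloor>) / 32 ^ k) \<omega>\<bar> \<le> 11 * (1 / 4) ^ k"
      by (auto dest: eventually_happens'[OF sequentially_bot])
    show ?case
    proof (intro allI impI notI)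
      fix t assume t: "\<delta> \<le> t" "t < real T" and hit: "(\<lambda>i j. B t \<omega> $$ (i, j)) \<in> S"
      have t0: "0 \<le> t" using t \<delta> by simp
      define j where "j = nat \<lfloor>t * 32 ^ k\<rfloor>"
      have fl: "real j = of_int \<lfloor>t * 32 ^ k\<rfloor>" using t0 by (simp add: j_def)
      have j: "real j \<le> t * 32 ^ k" "t * 32 ^ k - 1 \<le> real j" unfolding fl by linarith+
      have "real j < real T * 32 ^ k"
        by (rule le_less_trans[OF j(1) mult_strict_right_mono[OF t(2)]]) simp
      then have "real j < real (T * 32 ^ k)" by simp
      then have jT: "j < T * 32 ^ k" by (simp only: of_nat_less_iff)
      have "t - (1 / 32) ^ k \<le> real j / 32 ^ k"
        using divide_right_mono[OF j(2), of "32 ^ k"] by (simp add: diff_divide_distrib power_one_over)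
      then have "\<delta> / 2 \<le> real j / 32 ^ k" using t(1) k(3) by linarith
      then have jJ: "j \<in> J k" using jT by (simp add: J_def)
      obtain G where G: "G \<in> F k" "\<And>i j. i < n \<Longrightarrow> j < m \<Longrightarrow> cmod (B t \<omega> $$ (i, j) - G i j) \<le> C * (1 / 4) ^ k"
        using F(3)[OF hit, of k] by blast
      have "\<bar>real_coord (B (real j / 32 ^ k) \<omega>) e - co G e\<bar> \<le> \<rho> k" if e: "e \<in> coord_index n m" for e
      proof -
        obtain b i l where e': "e = (b, i, l)" "i < n" "l < m"
          using e by (auto simp: coord_index_def)
        have "\<bar>real_coord (B t \<omega>) e - co G e\<bar> \<le> cmod (B t \<omega> $$ (i, l) - G i l)"
          using abs_Re_le_cmod[of "B t \<omega> $$ (i, l) - G i l"] abs_Im_le_cmod[of "B t \<omega> $$ (i, l) - G i l"]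
          by (simp add: e' co_def)
        also have "\<dots> \<le> C * (1 / 4) ^ k" by (rule G(2)[OF e'(2,3)])
        finally have 1: "\<bar>real_coord (B t \<omega>) e - co G e\<bar> \<le> C * (1 / 4) ^ k" .
        have "\<bar>W e t \<omega> - W e (real j / 32 ^ k) \<omega>\<bar> \<le> 11 * (1 / 4) ^ k"
          unfolding j_def using e t t0 by (intro k(4)) (auto simp: K_def)
        then have "\<bar>real_coord (B t \<omega>) e - real_coord (B (real j / 32 ^ k) \<omega>) e\<bar> \<le> 11 * (1 / 4) ^ k"
          by (simp add: W_def)
        with 1 show ?thesis unfolding \<rho>_def distrib_right by linarith
      qed
      then have "\<omega> \<in> E k j G" using k(1) by (simp add: E_def)
      with jJ G(1) have "\<omega> \<in> A k" unfolding A_def by blast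
      with k(2) show False by simp
    qed
  qed
qed

section \<open>Absence of collisions\<close>

theorem corollary2:
  fixes M :: "'a measure" and n m :: nat
    and X0 :: "'a \<Rightarrow> complex mat" and X :: "real \<Rightarrow> 'a \<Rightarrow> complex mat"
    and l :: "nat \<Rightarrow> real \<Rightarrow> 'a \<Rightarrow> real"
  assumes "1 \<le> m" and "m \<le> n"
    and "laguerre_process M n m X0 X"
    and "\<And>t \<omega>. 0 \<le> t \<Longrightarrow> \<omega> \<in> space M \<Longrightarrow> lists_eigenvalues (X t \<omega>) (\<lambda>i. l i t \<omega>)"
    and "AE \<omega> in M. \<forall>i<m. \<forall>j<m. i \<noteq> j \<longrightarrow> l i 0 \<omega> \<noteq> l j 0 \<omega>"
  shows "AE \<omega> in M. collision_time m l \<omega> = \<infinity>"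
proof -
  obtain B where BM: "complex_brownian_matrix M n m B"
    and X: "\<And>t \<omega>. 0 \<le> t \<Longrightarrow> \<omega> \<in> space M \<Longrightarrow> X t \<omega> = mat_adjoint (B t \<omega>) * B t \<omega>"
    using assms(3) unfolding laguerre_process_def by blast
  have nm: "0 < n" "0 < m" using assms(1,2) by auto
  have car: "B t \<omega> \<in> carrier_mat n m" if "0 \<le> t" "\<omega> \<in> space M" for t \<omega>
    using BM that unfolding complex_brownian_matrix_def by blast
  have pos: "AE \<omega> in M. \<forall>p q r s N T. p < m \<longrightarrow> q < m \<longrightarrow> p \<noteq> q \<longrightarrow> r < n \<longrightarrow> s < n \<longrightarrow> r \<noteq> s \<longrightarrow> 0 < N \<longrightarrow>
      (\<forall>t. 1 / real (Suc T) \<le> t \<longrightarrow> t < real T \<longrightarrow>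
         (\<lambda>i j. B t \<omega> $$ (i, j)) \<notin> fst ` independent_image_pairs n m p q r s (real N))"
    unfolding AE_all_countable
    by (intro allI AE_impI brownian_matrix_avoids_thin[OF BM nm] thin_independent_image_pairs) auto
  have null: "AE \<omega> in M. \<forall>p q N T. p < m \<longrightarrow> q < m \<longrightarrow> p \<noteq> q \<longrightarrow>
      (\<forall>t. 1 / real (Suc T) \<le> t \<longrightarrow> t < real T \<longrightarrow>
         (\<lambda>i j. B t \<omega> $$ (i, j)) \<notin> fst ` null_pairs n m p q (real N))"
    unfolding AE_all_countable
    by (intro allI AE_impI brownian_matrix_avoids_thin[OF BM nm] thin_null_pairs assms(2)) auto
  from pos null assms(5) AE_space show ?thesis
  proof eventually_elim
    case (elim \<omega>)
    have "l i t \<omega> \<noteq> l j t \<omega>" if t: "0 \<le> t" and ij: "i < m" "j < m" "i \<noteq> j" for t i j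
    proof (cases "t = 0")
      case True
      then show ?thesis using elim(3) ij by blast
    next
      case False
      with t have "0 < t" by simp
      show ?thesis
      proof
        assume eq: "l i t \<omega> = l j t \<omega>"
        have le: "lists_eigenvalues (mat_adjoint (B t \<omega>) * B t \<omega>) (\<lambda>i. l i t \<omega>)"
          using assms(4)[OF t elim(4)] X[OF t elim(4)] by simp
        obtain p q u v where pq: "p < m" "q < m" "p \<noteq> q"
          and ep: "eigen_pair n m p q (\<lambda>i j. B t \<omega> $$ (i, j)) u v (l i t \<omega>)"
          using double_eigenvalue_eigen_pair[OF car[OF t elim(4)] le ij eq] by blast
        \<comment> \<open>a single natural number bounds the time from above and, inversely, from below\<close>
        obtain T :: nat where T: "max t (1 / t) < real T" using reals_Archimedean2 by blast
        then have "t < real T" "1 / t < real T" by auto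
        then have "1 / real (Suc T) \<le> t" using \<open>0 < t\<close> by (simp add: field_simps)
        from eigen_pair_cases[OF ep pq(1,2)] show False
        proof (elim disjE exE conjE)
          fix r s and N :: nat
          assume "r < n" "s < n" "r \<noteq> s" "0 < real N"
            "(\<lambda>i j. B t \<omega> $$ (i, j)) \<in> fst ` independent_image_pairs n m p q r s (real N)"
          then show False
            using elim(1)[rule_format, of p q r s N T t] pq \<open>t < real T\<close> \<open>1 / real (Suc T) \<le> t\<close> by simp
        next
          fix N :: nat
          assume "(\<lambda>i j. B t \<omega> $$ (i, j)) \<in> fst ` null_pairs n m p q (real N)"
          then show False
            using elim(2)[rule_format, of p q T t N] pq \<open>t < real T\<close> \<open>1 / real (Suc T) \<le> t\<close> by simp
        qed
      qed
    qed
    then have "{ereal t | t. 0 \<le> t \<and> (\<exists>i<m. \<exists>j<m. i \<noteq> j \<and> l i t \<omega> = l j t \<omega>)} = {}" by blast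
    then show ?case unfolding collision_time_def by (simp only: Inf_empty top_ereal_def)
  qed
qed

end
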